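(* Let $\{\lambda_m\}_{m=1}^{M}$ and $\{\mu_n\}_{n=1}^{N}$ be any nonnegative nonincreasing sequences. Every sequence of vectors $F=\{f_n\}_{n=1}^{N}$ in $\mathbb{H}_M$ whose frame operator $FF^*$ has spectrum $\{\lambda_m\}_{m=1}^{M}$ and which satisfies $\|f_n\|^2=\mu_n$ for all $n$ can be constructed by the following process: A. Pick a sequence of eigensteps $\{\{\lambda_{n;m}\}_{m=1}^{M}\}_{n=0}^{N}$ for $\{\lambda_m\}_{m=1}^{M}$ and $\{\mu_n\}_{n=1}^{N}$. B. For each $n=1,\dotsc,N$, consider the polynomial $$p_n(x):=\prod_{m=1}^{M}(x-\lambda_{n;m}).$$ Take any $f_1\in\mathbb{H}_M$ such that $\|f_1\|^2=\mu_1$. For each $n=1,\dotsc,N-1$, choose any $f_{n+1}\in\mathbb{H}_M$ such that $$\|P_{n;\lambda}f_{n+1}\|^2=-\lim_{x\rightarrow\lambda}(x-\lambda)\frac{p_{n+1}(x)}{p_n(x)}$$ for all $\lambda\in\{\lambda_{n;m}\}_{m=1}^{M}$, where $P_{n;\lambda}$ denotes the orthogonal projection operator onto the eigenspace $\mathrm{N}(\lambda\mathrm{I}-F_nF_n^* )$ of the frame operator $F_nF_n^*$ of $F_n=\{f_{n'}\}_{n'=1}^{n}$. The limit in this display exists and is nonpositive. Conversely, any $F$ constructed by this process has $\{\lambda_m\}_{m=1}^{M}$ as the spectrum of $FF^*$ and $\|f_n\|^2=\mu_n$ for all $n$. Moreover, for any $F$ constructed in this manner, the spectrum of $F_nF_n^*$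 is $\{\lambda_{n;m}\}_{m=1}^{M}$ for all $n=1,\dotsc,N$.
   Context: $\mathbb{K}$ is either $\mathbb{R}$ or $\mathbb{C}$, and $\mathbb{H}_M$ is an $M$-dimensional Hilbert space over $\mathbb{K}$. A finite sequence of vectors $F=\{f_n\}_{n=1}^{N}$ in $\mathbb{H}_M$ is identified with its synthesis operator $F:\mathbb{K}^N\to\mathbb{H}_M$, $Fg=\sum_{n=1}^N g(n)f_n$ (the $M\times N$ matrix with columns $f_n$ when $\mathbb{H}_M=\mathbb{K}^M$). Its frame operator is $FF^*=\sum_{n=1}^N f_nf_n^*:\mathbb{H}_M\to\mathbb{H}_M$, where $f_n^*f=\langle f,f_n\rangle$. The vectors are not required to span $\mathbb{H}_M$. "Spectrum" means the list of the $M$ eigenvalues, repeated according to multiplicity and arranged in nonincreasing order. $\mathrm{N}(\cdot)$ denotes the null space. Interlacing: for nonincreasing sequences, $\{\beta_m\}_{m=1}^{M}\sqsubseteq\{\gamma_m\}_{m=1}^{M}$ ("$\{\gamma_m\}$ interlaces on $\{\beta_m\}$") means $\beta_M\leq\gamma_M\leq\beta_{M-1}\leq\gamma_{M-1}\leq\dots\leq\beta_2\leq\gamma_2\leq\beta_1\leq\gamma_1$. Eigensteps: given nonnegative nonincreasing sequences $\{\lambda_m\}_{m=1}^{M}$ and $\{\mu_n\}_{n=1}^{N}$, a sequence of eigensteps is a doubly-indexed sequence $\{\{\lambda_{n;m}\}_{m=1}^{M}\}_{n=0}^{N}$, each $\{\lambda_{n;m}\}_{m=1}^M$ being nonnegative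 and nonincreasing in $m$, such that: (i) $\lambda_{0;m}=0$ for all $m=1,\dotsc,M$; (ii) $\lambda_{N;m}=\lambda_m$ for all $m=1,\dotsc,M$; (iii) $\{\lambda_{n-1;m}\}_{m=1}^{M}\sqsubseteq\{\lambda_{n;m}\}_{m=1}^{M}$ for all $n=1,\dotsc,N$; (iv) $\sum_{m=1}^{M}\lambda_{n;m}=\sum_{n'=1}^{n}\mu_{n'}$ for all $n=1,\dotsc,N$. The theorem does not claim that eigensteps, or such an $F$, exist for given $\{\lambda_m\}$ and $\{\mu_n\}$. "Can be constructed by the process" means that $F$ is obtained for some admissible sequence of choices in Steps A and B. *)

theory Defs
  imports "HOL-Analysis.Analysis"
begin

text \<open>
  The scalars. A normed field over the reals with a ring endomorphism satisfying the last axiom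
  below is isometrically isomorphic either to the reals with the identity or to the complex
  numbers with conjugation, because every element x is a root of the real polynomial
  t^2 - (x + conjg x) t + |x|^2. The class thus says exactly that the scalar field is one of these
  two, and both are instances.
\<close>

class real_or_complex = real_normed_field +
  fixes conjg :: "'a \<Rightarrow> 'a"
  assumes conjg_add: "conjg (x + y) = conjg x + conjg y"
    and conjg_mult: "conjg (x * y) = conjg x * conjg y"
    and mult_conjg: "x * conjg x = (norm x)\<^sup>2 *\<^sub>R 1"

instantiation real :: real_or_complex
begin
definition conjg_real :: "real \<Rightarrow> real" where "conjg_real x = x"
instance
  by standard (auto simp: conjg_real_def power2_eq_square)
end

instantiation complex :: real_or_complex
begin
definition conjg_complex :: "complex \<Rightarrow> complex" where "conjg_complex z = cnj z"
instance
  by standard (auto simp: conjg_complex_def complex_norm_square[symmetric] scaleR_conv_of_real)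
end

text \<open>
  An M-dimensional Hilbert space; completeness is automatic in finite dimension. The inner product
  is linear in its first argument.
\<close>

locale hilbert_space_dim = vector_space scl
  for scl :: "'k::real_or_complex \<Rightarrow> 'v::ab_group_add \<Rightarrow> 'v" +
  fixes ip :: "'v \<Rightarrow> 'v \<Rightarrow> 'k" and M :: nat
  assumes ip_add_left: "ip (x + y) z = ip x z + ip y z"
    and ip_scale_left: "ip (scl c x) z = c * ip x z"
    and ip_commute: "ip y x = conjg (ip x y)"
    and ip_nonneg: "\<exists>r\<ge>0. ip x x = of_real r"
    and ip_definite: "ip x x = 0 \<Longrightarrow> x = 0"
    and finite_dim: "\<exists>B. finite B \<and> span B = UNIV"
    and dim_space: "dim UNIV = M"

lemma euclidean_space_hilbert_space_dim:
  "hilbert_space_dim scaleR (inner :: 'v::euclidean_space \<Rightarrow> 'v \<Rightarrow> real) DIM('v)"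
proof -
  have span: "module.span scaleR = (span :: 'v set \<Rightarrow> 'v set)"
    by (simp add: span_raw_def)
  have dim: "vector_space.dim scaleR = (dim :: 'v set \<Rightarrow> nat)"
    by (simp add: dim_raw_def)
  show ?thesis
  proof (intro hilbert_space_dim.intro hilbert_space_dim_axioms.intro)
    show "\<exists>B. finite B \<and> module.span scaleR B = (UNIV :: 'v set)"
      unfolding span using span_Basis finite_Basis by blast
    show "vector_space.dim scaleR (UNIV :: 'v set) = DIM('v)"
      unfolding dim by simp
  qed (auto simp: inner_left_distrib inner_right_distrib conjg_real_def inner_commute real_vector.vector_space_axioms)
qed

lemma complex_cart_hilbert_space_dim:
  "hilbert_space_dim (*s) (\<lambda>x y :: complex ^ 'n. \<Sum>i\<in>UNIV. x $ i * cnj (y $ i)) CARD('n)"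
proof (intro hilbert_space_dim.intro hilbert_space_dim_axioms.intro)
  show "vector_space ((*s) :: complex \<Rightarrow> complex ^ 'n \<Rightarrow> complex ^ 'n)"
    by (rule vec.vector_space_axioms)
  show "\<exists>B. finite B \<and> vec.span B = (UNIV :: (complex ^ 'n) set)"
    using vec.span_Basis vec.finite_Basis by blast
  show "vec.dim (UNIV :: (complex ^ 'n) set) = CARD('n)"
    by (simp add: card_cart_basis)
  fix x y z :: "complex ^ 'n" and c :: complex
  have sq: "(\<Sum>i\<in>UNIV. x $ i * cnj (x $ i)) = of_real (\<Sum>i\<in>UNIV. (cmod (x $ i))\<^sup>2)"
    by (simp add: complex_norm_square del: of_real_power)
  show "(\<Sum>i\<in>UNIV. (x + y) $ i * cnj (z $ i)) =
        (\<Sum>i\<in>UNIV. x $ i * cnj (z $ i)) + (\<Sum>i\<in>UNIV. y $ i * cnj (z $ i))"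
    by (simp add: distrib_right sum.distrib)
  show "(\<Sum>i\<in>UNIV. (c *s x) $ i * cnj (z $ i)) = c * (\<Sum>i\<in>UNIV. x $ i * cnj (z $ i))"
    by (simp add: sum_distrib_left mult.assoc)
  show "(\<Sum>i\<in>UNIV. y $ i * cnj (x $ i)) = conjg (\<Sum>i\<in>UNIV. x $ i * cnj (y $ i))"
    by (simp add: conjg_complex_def mult.commute)
  show "\<exists>r\<ge>0. (\<Sum>i\<in>UNIV. x $ i * cnj (x $ i)) = of_real r"
    unfolding sq by (intro exI[of _ "\<Sum>i\<in>UNIV. (cmod (x $ i))\<^sup>2"]) (simp add: sum_nonneg)
  show "(\<Sum>i\<in>UNIV. x $ i * cnj (x $ i)) = 0 \<Longrightarrow> x = 0"
    unfolding sq of_real_eq_0_iff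
    by (subst (asm) sum_nonneg_eq_0_iff) (auto simp: vec_eq_iff)
qed

definition hnorm :: "('v \<Rightarrow> 'v \<Rightarrow> 'k::real_or_complex) \<Rightarrow> 'v \<Rightarrow> real" where
  "hnorm ip x = sqrt (norm (ip x x))"

text \<open>
  Finite sequences are functions on the natural numbers of which only the values at 1, ..., N
  matter; the frame operator of the first n vectors of F is \<open>frame_operator scl ip F n\<close>.
\<close>

definition frame_operator ::
  "('k::real_or_complex \<Rightarrow> 'v::ab_group_add \<Rightarrow> 'v) \<Rightarrow> ('v \<Rightarrow> 'v \<Rightarrow> 'k) \<Rightarrow> (nat \<Rightarrow> 'v) \<Rightarrow> nat \<Rightarrow> 'v \<Rightarrow> 'v"
  where "frame_operator scl ip F n x = (\<Sum>k\<in>{1..n}. scl (ip x (F k)) (F k))"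

definition eigenspace ::
  "('k::real_or_complex \<Rightarrow> 'v::ab_group_add \<Rightarrow> 'v) \<Rightarrow> ('v \<Rightarrow> 'v) \<Rightarrow> 'k \<Rightarrow> 'v set"
  where "eigenspace scl T c = {x. scl c x - T x = 0}"

text \<open>
  The spectrum as a nonincreasing list of M eigenvalues, each repeated as often as the dimension
  of its eigenspace. It is only used for self-adjoint operators, for which the algebraic and the
  geometric multiplicity agree.
\<close>

definition is_spectrum ::
  "('k::real_or_complex \<Rightarrow> 'v::ab_group_add \<Rightarrow> 'v) \<Rightarrow> ('v \<Rightarrow> 'v) \<Rightarrow> nat \<Rightarrow> (nat \<Rightarrow> real) \<Rightarrow> bool"
  where "is_spectrum scl T M lam \<longleftrightarrow>
    antimono_on {1..M} lam \<and>
    (\<forall>c. card {m\<in>{1..M}. of_real (lam m) = c} = vector_space.dim scl (eigenspace scl T c))"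

definition orth_proj ::
  "('v \<Rightarrow> 'v \<Rightarrow> 'k::real_or_complex) \<Rightarrow> 'v::ab_group_add set \<Rightarrow> 'v \<Rightarrow> 'v"
  where "orth_proj ip S x = (THE y. y \<in> S \<and> (\<forall>z\<in>S. ip (x - y) z = 0))"

definition interlaces :: "nat \<Rightarrow> (nat \<Rightarrow> real) \<Rightarrow> (nat \<Rightarrow> real) \<Rightarrow> bool" where
  "interlaces M b g \<longleftrightarrow>
    (\<forall>m\<in>{1..M}. b m \<le> g m) \<and> (\<forall>m\<in>{1..<M}. g (Suc m) \<le> b m)"

definition eigensteps ::
  "nat \<Rightarrow> nat \<Rightarrow> (nat \<Rightarrow> real) \<Rightarrow> (nat \<Rightarrow> real) \<Rightarrow> (nat \<Rightarrow> nat \<Rightarrow> real) \<Rightarrow> bool"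
  where "eigensteps M N lam mu E \<longleftrightarrow>
    (\<forall>n\<in>{0..N}. (\<forall>m\<in>{1..M}. 0 \<le> E n m) \<and> antimono_on {1..M} (E n)) \<and>
    (\<forall>m\<in>{1..M}. E 0 m = 0) \<and>
    (\<forall>m\<in>{1..M}. E N m = lam m) \<and>
    (\<forall>n\<in>{1..N}. interlaces M (E (n - 1)) (E n)) \<and>
    (\<forall>n\<in>{1..N}. (\<Sum>m\<in>{1..M}. E n m) = (\<Sum>k\<in>{1..n}. mu k))"

definition step_poly :: "nat \<Rightarrow> (nat \<Rightarrow> nat \<Rightarrow> real) \<Rightarrow> nat \<Rightarrow> real \<Rightarrow> real" where
  "step_poly M E n x = (\<Prod>m\<in>{1..M}. x - E n m)"

definition step_quotient :: "nat \<Rightarrow> (nat \<Rightarrow> nat \<Rightarrow> real) \<Rightarrow> nat \<Rightarrow> real \<Rightarrow> real \<Rightarrow> real" where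
  "step_quotient M E n l x = (x - l) * (step_poly M E (n + 1) x / step_poly M E n x)"

definition step_B ::
  "('k::real_or_complex \<Rightarrow> 'v::ab_group_add \<Rightarrow> 'v) \<Rightarrow> ('v \<Rightarrow> 'v \<Rightarrow> 'k) \<Rightarrow>
   nat \<Rightarrow> nat \<Rightarrow> (nat \<Rightarrow> real) \<Rightarrow> (nat \<Rightarrow> nat \<Rightarrow> real) \<Rightarrow> (nat \<Rightarrow> 'v) \<Rightarrow> bool"
  where "step_B scl ip M N mu E F \<longleftrightarrow>
    (1 \<le> N \<longrightarrow> (hnorm ip (F 1))\<^sup>2 = mu 1) \<and>
    (\<forall>n\<in>{1..<N}. \<forall>l\<in>E n ` {1..M}.
      (hnorm ip (orth_proj ip (eigenspace scl (frame_operator scl ip F n) (of_real l)) (F (n + 1))))\<^sup>2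
        = - Lim (at l) (step_quotient M E n l))"

end

theory Submission
  imports Defs "HOL-Computational_Algebra.Polynomial"
begin

text \<open>
Appending a vector \<open>f\<close> to a finite sequence changes its frame operator \<open>A\<close> into the rank-one
update \<open>B x = A x + \<langle>x, f\<rangle> f\<close>. The theorem says what such an update can do to the spectrum.
Let \<open>e\<close> and \<open>u\<close> be orthonormal eigenbases of \<open>A\<close> and \<open>B\<close> with nonincreasing eigenvalues \<open>a\<close> and \<open>g\<close>,
and let \<open>p\<^sub>a\<close> and \<open>p\<^sub>g\<close> be the monic polynomials with these roots.

\<^item> The Courant--Fischer argument shows that \<open>g\<close> interlaces on \<open>a\<close>: the forms of \<open>A\<close> and \<open>B\<close> are compared
  on a vector orthogonal to suitably few of the \<open>e\<^sub>i\<close>, the \<open>u\<^sub>i\<close> and possibly \<open>f\<close>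
  (\<open>rank_one_interlaces\<close>).
\<^item> The quotient of the characteristic polynomials is the secular function
  \<open>p\<^sub>g(x) / p\<^sub>a(x) = 1 - (\<Sum>m. |\<langle>f, e\<^sub>m\<rangle>|\<^sup>2 / (x - a\<^sub>m))\<close> (\<open>rank_one_root_poly\<close>), so that its residue at \<open>l\<close> is
  minus the squared norm of the projection of \<open>f\<close> onto the \<open>l\<close>-eigenspace (\<open>rank_one_residue\<close>).

Hence the spectra of the partial frame operators of any \<open>F\<close> are eigensteps for which \<open>F\<close> satisfies
Step B; the sums of the eigensteps come out right because the trace of a frame operator is the sum of
the squared norms of the vectors (\<open>frame_trace\<close>).

For the converse, interlacing makes all poles of \<open>p\<^sub>g / p\<^sub>a\<close> simple, so a monic \<open>p\<^sub>g\<close> of the degree of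
\<open>p\<^sub>a\<close> is determined by its residues: the difference of two candidates is divisible by \<open>p\<^sub>a\<close> and has
smaller degree (\<open>root_poly_eq_of_residues\<close>). Both the true spectrum of the updated operator and the
next eigenstep interlace on the current spectrum and have the residues prescribed by Step B, so they
agree, and induction identifies all spectra. Only the first vector is special, since Step B gives its
norm instead of residues; but a list that interlaces on the zero list vanishes after its first entry,
which is therefore the trace. The norms of the other vectors are differences of traces.

The scalar field is given abstractly, so the spectral theorem is proved from the inner product alone:
the largest eigenvalue is the supremum \<open>l\<close> of the Rayleigh quotient, because an invertible \<open>l - T\<close>
would have a bounded inverse and would thus keep the Rayleigh quotient away from \<open>l\<close>
(\<open>top_eigenvector\<close>).
\<close>

section \<open>Monic real polynomials with prescribed roots\<close>

definition root_poly :: "nat set \<Rightarrow> (nat \<Rightarrow> real) \<Rightarrow> real poly" where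
  "root_poly I a = (\<Prod>m\<in>I. [:- a m, 1:])"

definition root_count :: "nat set \<Rightarrow> (nat \<Rightarrow> real) \<Rightarrow> real \<Rightarrow> nat" where
  "root_count I a c = card {m\<in>I. a m = c}"

lemma poly_root_poly: "poly (root_poly I a) x = (\<Prod>m\<in>I. x - a m)"
  by (simp add: root_poly_def poly_prod algebra_simps)

lemma root_poly_nonzero: "root_poly I a \<noteq> 0"
  by (cases "finite I") (auto simp: root_poly_def)

lemma degree_root_poly: "degree (root_poly I a) = card I"
  by (simp add: root_poly_def degree_prod_sum_eq)

lemma monic_root_poly: "lead_coeff (root_poly I a) = 1"
  by (simp add: root_poly_def lead_coeff_prod)

lemma root_poly_insert:
  "finite I \<Longrightarrow> m \<notin> I \<Longrightarrow> root_poly (insert m I) a = [:- a m, 1:] * root_poly I a"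
  by (simp add: root_poly_def)

lemma root_poly_split:
  assumes "finite I"
  shows "root_poly I a = root_poly {m\<in>I. P m} a * root_poly {m\<in>I. \<not> P m} a"
proof -
  have "I = {m\<in>I. P m} \<union> {m\<in>I. \<not> P m}" by auto
  then show ?thesis
    unfolding root_poly_def
    using assms by (subst prod.union_disjoint[symmetric]) auto
qed

lemma root_poly_const: "(\<And>m. m \<in> I \<Longrightarrow> a m = c) \<Longrightarrow> root_poly I a = [:- c, 1:] ^ card I"
  by (simp add: root_poly_def)

lemma root_poly_factor:
  assumes "finite I"
  shows "root_poly I a = [:- c, 1:] ^ root_count I a c * root_poly {m\<in>I. a m \<noteq> c} a"
  using root_poly_split[OF assms, of a "\<lambda>m. a m = c"] root_poly_const[of "{m\<in>I. a m = c}" a c]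
  by (simp add: root_count_def)

lemma poly_root_poly_nonzero: "finite I \<Longrightarrow> (\<And>m. m \<in> I \<Longrightarrow> a m \<noteq> x) \<Longrightarrow> poly (root_poly I a) x \<noteq> 0"
  by (auto simp: poly_root_poly)

lemma order_root_poly:
  assumes "finite I"
  shows "order c (root_poly I a) = root_count I a c"
proof -
  have "order c (root_poly {m\<in>I. a m \<noteq> c} a) = 0"
    using assms by (intro order_0I poly_root_poly_nonzero) auto
  then show ?thesis
    using root_poly_nonzero[of I a]
    by (subst root_poly_factor[OF assms, of a c]) (simp add: order_mult root_poly_nonzero order_power_n_n del: mult_pCons_left)
qed

text \<open>
  Powers of distinct linear factors are coprime, so divisibility can be checked one root at a time.
  Removing one linear factor from both polynomials lowers the order of the dividend by exactly what is
  needed for the induction.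
\<close>

lemma root_poly_dvdI:
  assumes "finite I" "\<And>c. [:- c, 1:] ^ root_count I a c dvd D"
  shows "root_poly I a dvd D"
  using assms
proof (induction I arbitrary: D rule: finite_induct)
  case empty
  then show ?case by (simp add: root_poly_def)
next
  case (insert i I)
  show ?case
  proof (cases "D = 0")
    case False
    have cnt: "root_count (insert i I) a c = root_count I a c + (if c = a i then 1 else 0)" for c
    proof -
      have "{m \<in> insert i I. a m = c} = (if c = a i then insert i {m\<in>I. a m = c} else {m\<in>I. a m = c})"
        by auto
      then show ?thesis using insert.hyps by (simp add: root_count_def)
    qed
    have "[:- a i, 1:] ^ 1 dvd D"
      using insert.prems[of "a i"] unfolding cnt by (rule power_le_dvd) simp
    then obtain D' where D': "D = [:- a i, 1:] * D'" by (auto simp: dvd_def)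
    with False have nz: "D' \<noteq> 0" by auto
    have "[:- c, 1:] ^ root_count I a c dvd D'" for c
    proof -
      have "root_count (insert i I) a c \<le> order c D"
        using insert.prems[of c] False order_divides by blast
      also have "order c D = order c [:- a i, 1:] + order c D'"
        unfolding D' using False D' by (intro order_mult) auto
      also have "order c [:- a i, 1:] = (if c = a i then 1 else 0)"
        using order_power_n_n[of c 1] by (auto intro: order_0I)
      finally show ?thesis
        using cnt[of c] by (auto simp: order_divides split: if_splits)
    qed
    then have "root_poly I a dvd D'" by (rule insert.IH)
    then show ?thesis
      unfolding D' root_poly_insert[OF insert.hyps] by (rule mult_dvd_mono[OF dvd_refl])
  qed simp
qed

lemma dvd_small_degree_eq_0:
  fixes p r :: "real poly"
  assumes "p dvd r" "degree r \<le> degree p" "coeff r (degree p) = 0"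
  shows "r = 0"
  using eq_zero_or_degree_less[OF assms(2,3)] dvd_imp_degree_le[OF assms(1)] by (metis leD)

text \<open>
  Two monic polynomials of the same degree differ by a polynomial of smaller degree, and only zero is
  then divisible by a polynomial of that degree.
\<close>

lemma root_poly_eqI:
  assumes "finite I" "card I = card J" "root_poly I a dvd root_poly J b - root_poly I d"
  shows "root_poly J b = root_poly I d"
proof -
  let ?r = "root_poly J b - root_poly I d"
  have "?r = 0"
  proof (rule dvd_small_degree_eq_0[OF assms(3)])
    show "degree ?r \<le> degree (root_poly I a)"
      using assms(2) degree_root_poly by (intro degree_diff_le) auto
    show "coeff ?r (degree (root_poly I a)) = 0"
      using monic_root_poly[of J b] monic_root_poly[of I d] assms(2) by (simp add: degree_root_poly)
  qed
  then show ?thesis by simp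
qed

lemma count_mset_root_count: "count (mset (map a [1..<Suc M])) c = root_count {1..M} a c"
proof -
  have "count (mset (map a [1..<Suc M])) c = length (filter (\<lambda>m. a m = c) [1..<Suc M])"
    unfolding count_mset count_list_eq_length_filter filter_map length_map by (simp only: comp_def eq_commute)
  also have "\<dots> = card (set (filter (\<lambda>m. a m = c) [1..<Suc M]))"
    by (rule distinct_card[symmetric]) (simp del: upt_Suc)
  also have "set (filter (\<lambda>m. a m = c) [1..<Suc M]) = {m\<in>{1..M}. a m = c}"
    by (auto simp del: upt_Suc)
  finally show ?thesis by (simp only: root_count_def)
qed

text \<open>
  Both lists, read backwards, are the sorted list of the same multiset.
\<close>

lemma antimono_root_count_unique:
  assumes "antimono_on {1..M} a" "antimono_on {1..M} b" "root_count {1..M} a = root_count {1..M} b"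
    and "m \<in> {1..M}"
  shows "a m = b m"
proof -
  let ?l = "\<lambda>a. map a [1..<Suc M]"
  have "mset (?l a) = mset (?l b)"
    by (intro multiset_eqI) (simp only: count_mset_root_count assms(3))
  moreover have "sorted (rev (?l a))" if "antimono_on {1..M} a" for a :: "nat \<Rightarrow> real"
  proof -
    have "a (j + 1) \<le> a (i + 1)" if "i \<le> j" "j < M" for i j
      using that \<open>antimono_on {1..M} a\<close> by (auto intro: monotone_onD)
    then show ?thesis by (auto simp: sorted_rev_iff_nth_mono simp del: upt_Suc)
  qed
  ultimately have "?l a = ?l b"
    using assms(1,2) by (metis mset_rev properties_for_sort rev_rev_ident)
  then show ?thesis using assms(4) by (auto simp del: upt_Suc)
qed

section \<open>Interlacing lists and residues of quotients\<close>

text \<open>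
  The value \<open>g m\<close> is squeezed between \<open>a m\<close> and \<open>a (m - 1)\<close>, which coincide unless \<open>m\<close> is the first index
  of its block of equal values. A value of multiplicity \<open>k\<close> in \<open>a\<close> thus has multiplicity at least
  \<open>k - 1\<close> in \<open>g\<close>, which makes the poles of the quotient of the two polynomials simple.
\<close>

lemma interlaces_block:
  assumes "antimono_on {1..M} a" "interlaces M a g" "i \<in> {1..M}" "m \<in> {1..M}" "i < m" "a i = a m"
  shows "g m = a m"
proof -
  have "m - 1 \<in> {1..<M}" "Suc (m - 1) = m" "i \<le> m - 1" using assms by auto
  then have "g m \<le> a (m - 1)" "a (m - 1) \<le> a i"
    using assms(2) monotone_onD[OF assms(1), of i "m - 1"] assms(3)
    unfolding interlaces_def by (fastforce, fastforce)
  moreover have "a m \<le> g m" using assms unfolding interlaces_def by auto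
  ultimately show ?thesis using assms by simp
qed

lemma interlaces_block_upper:
  assumes "antimono_on {1..M} g" "interlaces M a g" "i \<in> {1..M}" "m \<in> {1..M}" "i < m" "g i = g m"
  shows "a i = g i"
proof -
  have "i \<in> {1..<M}" "Suc i \<le> m" using assms by auto
  then have "g (Suc i) \<le> a i" "g m \<le> g (Suc i)"
    using assms(2) monotone_onD[OF assms(1), of "Suc i" m] assms(4)
    unfolding interlaces_def by auto
  moreover have "a i \<le> g i" using assms(2,3) unfolding interlaces_def by auto
  ultimately show ?thesis using assms(6) by linarith
qed

lemma interlaces_root_count:
  assumes "antimono_on {1..M} g" "interlaces M a g"
  shows "root_count {1..M} g c \<le> Suc (root_count {1..M} a c)"
proof (cases "{m\<in>{1..M}. g m = c} = {}")
  case False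
  define G where "G = {m\<in>{1..M}. g m = c}"
  have fin: "finite G" "G \<noteq> {}" using False by (auto simp: G_def)
  define j where "j = Max G"
  have j: "j \<in> G" unfolding j_def using fin by (rule Max_in)
  have "a m = c" if m: "m \<in> G" "m \<noteq> j" for m
  proof -
    have "m < j" using Max_ge[OF fin(1) m(1)] m(2) unfolding j_def by linarith
    moreover have "m \<in> {1..M}" "j \<in> {1..M}" "g m = c" "g j = c" using m(1) j by (simp_all add: G_def)
    ultimately show ?thesis using interlaces_block_upper[OF assms, of m j] by simp
  qed
  then have "G - {j} \<subseteq> {m\<in>{1..M}. a m = c}" by (auto simp: G_def)
  then have "card (G - {j}) \<le> card {m\<in>{1..M}. a m = c}" by (intro card_mono) auto
  moreover have "card G = Suc (card (G - {j}))" using fin(1) j by (rule card.remove)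
  ultimately show ?thesis unfolding root_count_def G_def by linarith
next
  case True
  show ?thesis unfolding root_count_def True by simp
qed

text \<open>
  Here \<open>i\<close> is the first index of the block of \<open>l\<close>. Being the only index of the block at which \<open>g\<close> may
  differ from \<open>l\<close>, it contributes the only factor that does not cancel against the block.
\<close>

lemma interlaces_quotient_factor:
  assumes mono: "antimono_on {1..M} a" and l: "l \<in> a ` {1..M}"
  obtains i where "i \<in> {1..M}" "a i = l" "\<And>m. m \<in> {1..M} \<Longrightarrow> a m = l \<Longrightarrow> i \<le> m"
    and "\<And>g. interlaces M a g \<Longrightarrow> root_poly {1..M} g =
      [:- l, 1:] ^ (root_count {1..M} a l - 1) * ([:- g i, 1:] * root_poly {m\<in>{1..M}. a m \<noteq> l} g)"
proof -
  let ?B = "{m\<in>{1..M}. a m = l}"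
  define i where "i = Min ?B"
  have ne: "?B \<noteq> {}" using l by auto
  then have i: "i \<in> ?B" unfolding i_def by (intro Min_in) auto
  have least: "i \<le> m" if "m \<in> {1..M}" "a m = l" for m
    unfolding i_def using that by (intro Min_le) auto
  show thesis
  proof (rule that[of i])
    fix g assume int: "interlaces M a g"
    have B: "?B = insert i (?B - {i})" using i by auto
    have "g m = l" if "m \<in> ?B - {i}" for m
      using interlaces_block[OF mono int, of i m] that i least[of m] by auto
    then have "root_poly (?B - {i}) g = [:- l, 1:] ^ card (?B - {i})" by (rule root_poly_const)
    moreover have "card (?B - {i}) = root_count {1..M} a l - 1"
      using i by (simp add: root_count_def)
    moreover have "root_poly ?B g = [:- g i, 1:] * root_poly (?B - {i}) g"
      by (subst B, rule root_poly_insert) auto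
    ultimately show "root_poly {1..M} g =
      [:- l, 1:] ^ (root_count {1..M} a l - 1) * ([:- g i, 1:] * root_poly {m\<in>{1..M}. a m \<noteq> l} g)"
      using root_poly_split[of "{1..M}" g "\<lambda>m. a m = l"] by (simp add: ac_simps del: mult_pCons_left mult_pCons_right)
  qed (use i least in auto)
qed

lemma root_count_pos: "l \<in> a ` I \<Longrightarrow> finite I \<Longrightarrow> 0 < root_count I a l"
  by (auto simp: root_count_def card_gt_0_iff)

text \<open>
  The limit at a simple pole: one power of the linear factor in the denominator survives the
  cancellation with the numerator, and it is absorbed by \<open>x - l\<close>.
\<close>

lemma residue_tendsto:
  assumes k: "0 < root_count {1..M} a l"
    and D: "D = [:- l, 1:] ^ (root_count {1..M} a l - 1) * h"
  shows "((\<lambda>x. (x - l) * (poly D x / poly (root_poly {1..M} a) x)) \<longlongrightarrow>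
    poly h l / poly (root_poly {m\<in>{1..M}. a m \<noteq> l} a) l) (at l)"
proof (rule Lim_transform_eventually)
  let ?A = "root_poly {m\<in>{1..M}. a m \<noteq> l} a"
  have "poly ?A l \<noteq> 0" by (rule poly_root_poly_nonzero) auto
  then show "((\<lambda>x. poly h x / poly ?A x) \<longlongrightarrow> poly h l / poly ?A l) (at l)"
    by (intro tendsto_intros)
  have "poly h x / poly ?A x = (x - l) * (poly D x / poly (root_poly {1..M} a) x)" if "x \<noteq> l" for x
  proof -
    obtain k where "root_count {1..M} a l = Suc k" using k by (metis gr0_implies_Suc)
    then have "poly D x = (x - l) ^ k * poly h x"
      and "poly (root_poly {1..M} a) x = (x - l) ^ Suc k * poly ?A x"
      using D arg_cong[OF root_poly_factor[of "{1..M}" a l], of "\<lambda>p. poly p x"]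
      by (simp_all add: poly_power algebra_simps)
    with that show ?thesis by simp
  qed
  then show "\<forall>\<^sub>F x in at l. poly h x / poly ?A x = (x - l) * (poly D x / poly (root_poly {1..M} a) x)"
    by (auto simp: eventually_at_filter)
qed

text \<open>
  After cancellation the limit is \<open>l - g i\<close> times a product of quotients \<open>(l - g m) / (l - a m)\<close> over the
  indices outside the block of \<open>l\<close>. Interlacing puts \<open>g m\<close> on the same side of \<open>l\<close> as \<open>a m\<close>, so each
  quotient is nonnegative, while \<open>g i\<close> is at least \<open>a i = l\<close>.
\<close>

lemma interlaces_residue_nonpos:
  assumes "antimono_on {1..M} a" "interlaces M a g" "l \<in> a ` {1..M}"
  shows "\<exists>L\<le>0. ((\<lambda>x. (x - l) * (poly (root_poly {1..M} g) x / poly (root_poly {1..M} a) x)) \<longlongrightarrow> L) (at l)"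
proof -
  obtain i where i: "i \<in> {1..M}" "a i = l" "\<And>m. m \<in> {1..M} \<Longrightarrow> a m = l \<Longrightarrow> i \<le> m"
    and facs: "\<And>g. interlaces M a g \<Longrightarrow> root_poly {1..M} g =
      [:- l, 1:] ^ (root_count {1..M} a l - 1) * ([:- g i, 1:] * root_poly {m\<in>{1..M}. a m \<noteq> l} g)"
    by (rule interlaces_quotient_factor[OF assms(1,3)]) blast
  note fac = facs[OF assms(2)]
  let ?R = "{m\<in>{1..M}. a m \<noteq> l}"
  let ?L = "poly ([:- g i, 1:] * root_poly ?R g) l / poly (root_poly ?R a) l"
  have "?L = (l - g i) * (\<Prod>m\<in>?R. (l - g m) / (l - a m))"
  proof -
    have "poly [:- g i, 1:] l = l - g i" by simp
    then show ?thesis by (simp only: poly_mult poly_root_poly prod_dividef times_divide_eq_right)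
  qed
  also have "\<dots> \<le> 0"
  proof (rule mult_nonpos_nonneg)
    show "l - g i \<le> 0" using i assms(2) unfolding interlaces_def by auto
    show "0 \<le> (\<Prod>m\<in>?R. (l - g m) / (l - a m))"
    proof (rule prod_nonneg)
      fix m assume m: "m \<in> ?R"
      show "0 \<le> (l - g m) / (l - a m)"
      proof (cases "a m < l")
        case True
        then have "i < m"
          using monotone_onD[OF assms(1), of m i] i m by fastforce
        then have "m - 1 \<in> {1..<M}" "Suc (m - 1) = m" "i \<le> m - 1" using m i by auto
        then have "g m \<le> a (m - 1)" "a (m - 1) \<le> a i"
          using assms(2) monotone_onD[OF assms(1), of i "m - 1"] i(1)
          unfolding interlaces_def by (fastforce, fastforce)
        then show ?thesis using True i by simp
      next
        case False
        then have "l < a m" "a m \<le> g m" using m assms(2) unfolding interlaces_def by auto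
        then show ?thesis by (simp add: divide_nonpos_neg)
      qed
    qed
  qed
  finally have "?L \<le> 0" .
  moreover have "0 < root_count {1..M} a l" using root_count_pos[OF assms(3)] by simp
  ultimately show ?thesis using residue_tendsto[OF _ fac] by blast
qed

text \<open>
  Uniqueness in a partial fraction decomposition. The difference of the two numerators has only simple
  poles over \<open>root_poly {1..M} a\<close>, and all its residues vanish; so it is divisible by the denominator,
  although its degree is smaller.
\<close>

lemma root_poly_eq_of_residues:
  assumes mono: "antimono_on {1..M} a" and int: "interlaces M a g" "interlaces M a h"
    and lim: "\<And>l. l \<in> a ` {1..M} \<Longrightarrow> \<exists>L.
      ((\<lambda>x. (x - l) * (poly (root_poly {1..M} g) x / poly (root_poly {1..M} a) x)) \<longlongrightarrow> L) (at l) \<and>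
      ((\<lambda>x. (x - l) * (poly (root_poly {1..M} h) x / poly (root_poly {1..M} a) x)) \<longlongrightarrow> L) (at l)"
  shows "root_poly {1..M} g = root_poly {1..M} h"
proof (rule root_poly_eqI)
  let ?D = "root_poly {1..M} g - root_poly {1..M} h"
  show "root_poly {1..M} a dvd ?D"
  proof (rule root_poly_dvdI)
    fix l
    show "[:- l, 1:] ^ root_count {1..M} a l dvd ?D"
    proof (cases "l \<in> a ` {1..M}")
      case True
      let ?k = "root_count {1..M} a l" let ?A = "root_poly {m\<in>{1..M}. a m \<noteq> l} a"
      have pos: "0 < ?k" using root_count_pos[OF True] by simp
      obtain i where fac: "\<And>g. interlaces M a g \<Longrightarrow> root_poly {1..M} g =
        [:- l, 1:] ^ (?k - 1) * ([:- g i, 1:] * root_poly {m\<in>{1..M}. a m \<noteq> l} g)"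
        by (rule interlaces_quotient_factor[OF mono True]) blast
      have D: "\<exists>d. ?D = [:- l, 1:] ^ (?k - 1) * d"
        unfolding fac[OF int(1)] fac[OF int(2)] right_diff_distrib[symmetric] by blast
      then obtain d where d: "?D = [:- l, 1:] ^ (?k - 1) * d" by blast
      obtain L where L:
        "((\<lambda>x. (x - l) * (poly (root_poly {1..M} g) x / poly (root_poly {1..M} a) x)) \<longlongrightarrow> L) (at l)"
        "((\<lambda>x. (x - l) * (poly (root_poly {1..M} h) x / poly (root_poly {1..M} a) x)) \<longlongrightarrow> L) (at l)"
        using lim[OF True] by blast
      have "((\<lambda>x. (x - l) * (poly ?D x / poly (root_poly {1..M} a) x)) \<longlongrightarrow> 0) (at l)"
        using tendsto_diff[OF L] by (simp add: diff_divide_distrib right_diff_distrib)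
      with residue_tendsto[OF pos d] have "poly d l / poly ?A l = 0"
        by (intro tendsto_unique[where F = "at l"]) auto
      moreover have "poly ?A l \<noteq> 0" by (rule poly_root_poly_nonzero) auto
      ultimately have "[:- l, 1:] dvd d" by (simp add: poly_eq_0_iff_dvd)
      then have "[:- l, 1:] ^ (?k - 1) * [:- l, 1:] dvd ?D"
        unfolding d by (rule mult_dvd_mono[OF dvd_refl])
      moreover have "[:- l, 1:] ^ (?k - 1) * [:- l, 1:] = [:- l, 1:] ^ ?k"
        using pos by (metis power_minus_mult)
      ultimately show ?thesis by metis
    next
      case False
      then have "{m \<in> {1..M}. a m = l} = {}" by auto
      then show ?thesis by (simp only: root_count_def card.empty power_0 one_dvd)
    qed
  qed simp
qed simp_all

lemma step_quotient_root_poly: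
  "step_quotient M E n l = (\<lambda>x. (x - l) * (poly (root_poly {1..M} (E (Suc n))) x / poly (root_poly {1..M} (E n)) x))"
  by (simp add: step_quotient_def step_poly_def poly_root_poly fun_eq_iff)

lemma eigensteps_residue_nonpos:
  assumes "eigensteps M N lam mu E" "n \<in> {0..<N}" "l \<in> E n ` {1..M}"
  shows "\<exists>L\<le>0. (step_quotient M E n l \<longlongrightarrow> L) (at l)"
proof -
  have "antimono_on {1..M} (E n)" using assms(1,2) by (simp add: eigensteps_def)
  moreover have "interlaces M (E n) (E (Suc n))"
  proof -
    have "Suc n \<in> {1..N}" using assms(2) by simp
    then have "interlaces M (E (Suc n - 1)) (E (Suc n))" using assms(1) unfolding eigensteps_def by blast
    then show ?thesis by simp
  qed
  ultimately show ?thesis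
    unfolding step_quotient_root_poly using interlaces_residue_nonpos assms(3) by blast
qed

section \<open>The secular function of a rank-one update\<close>

text \<open>
  The numerator of the secular function, that is, \<open>1 - (\<Sum>m. w m / (x - a m))\<close> multiplied by the product
  of all \<open>x - a m\<close>. Multiplying out keeps it meaningful at the points \<open>a m\<close> and for repeated values.
\<close>

definition secular_poly :: "nat \<Rightarrow> (nat \<Rightarrow> real) \<Rightarrow> (nat \<Rightarrow> real) \<Rightarrow> real poly" where
  "secular_poly M a w =
    root_poly {1..M} a - (\<Sum>m\<in>{1..M}. smult (w m) (root_poly ({1..M} - {m}) a))"

lemma poly_secular_poly:
  assumes "\<And>m. m \<in> {1..M} \<Longrightarrow> a m \<noteq> x"
  shows "poly (secular_poly M a w) x / poly (root_poly {1..M} a) x = 1 - (\<Sum>m\<in>{1..M}. w m / (x - a m))"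
proof -
  let ?p = "poly (root_poly {1..M} a) x"
  have nz: "?p \<noteq> 0" using assms by (intro poly_root_poly_nonzero) auto
  have "poly (root_poly ({1..M} - {m}) a) x = ?p / (x - a m)" if "m \<in> {1..M}" for m
    using assms[OF that] that by (simp add: poly_root_poly prod_diff1)
  then have "(\<Sum>m\<in>{1..M}. w m * poly (root_poly ({1..M} - {m}) a) x) = ?p * (\<Sum>m\<in>{1..M}. w m / (x - a m))"
    by (subst sum_distrib_left) (intro sum.cong, auto)
  then have "poly (secular_poly M a w) x = ?p * (1 - (\<Sum>m\<in>{1..M}. w m / (x - a m)))"
    by (simp only: secular_poly_def poly_diff poly_sum poly_smult right_diff_distrib mult_1_right)
  with nz show ?thesis by simp
qed

lemma secular_poly_residue:
  shows "((\<lambda>x. (x - l) * (poly (secular_poly M a w) x / poly (root_poly {1..M} a) x)) \<longlongrightarrow>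
    - (\<Sum>m\<in>{m\<in>{1..M}. a m = l}. w m)) (at l)"
proof (rule Lim_transform_eventually)
  have "((\<lambda>x. w m * (if a m = l then 1 else (x - l) / (x - a m))) \<longlongrightarrow> (if a m = l then w m else 0)) (at l)" for m
    by (auto intro!: tendsto_eq_intros)
  then have "((\<lambda>x. (x - l) - (\<Sum>m\<in>{1..M}. w m * (if a m = l then 1 else (x - l) / (x - a m)))) \<longlongrightarrow>
      (l - l) - (\<Sum>m\<in>{1..M}. if a m = l then w m else 0)) (at l)"
    by (intro tendsto_intros)
  moreover have "(\<Sum>m\<in>{1..M}. if a m = l then w m else 0) = (\<Sum>m\<in>{m\<in>{1..M}. a m = l}. w m)"
    by (rule sum.inter_filter[symmetric]) simp
  ultimately show "((\<lambda>x. (x - l) - (\<Sum>m\<in>{1..M}. w m * (if a m = l then 1 else (x - l) / (x - a m)))) \<longlongrightarrow>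
      - (\<Sum>m\<in>{m\<in>{1..M}. a m = l}. w m)) (at l)" by simp
  have "\<forall>\<^sub>F x in at l. x \<notin> insert l (a ` {1..M})"
    using islimpt_finite[of "insert l (a ` {1..M})" l] by (simp add: islimpt_iff_eventually)
  then show "\<forall>\<^sub>F x in at l. (x - l) - (\<Sum>m\<in>{1..M}. w m * (if a m = l then 1 else (x - l) / (x - a m))) =
      (x - l) * (poly (secular_poly M a w) x / poly (root_poly {1..M} a) x)"
  proof eventually_elim
    case (elim x)
    then have "poly (secular_poly M a w) x / poly (root_poly {1..M} a) x = 1 - (\<Sum>m\<in>{1..M}. w m / (x - a m))"
      by (intro poly_secular_poly) auto
    moreover have "(\<Sum>m\<in>{1..M}. w m * (if a m = l then 1 else (x - l) / (x - a m)))
        = (x - l) * (\<Sum>m\<in>{1..M}. w m / (x - a m))"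
      unfolding sum_distrib_left using elim by (intro sum.cong) auto
    ultimately show ?case by (simp add: right_diff_distrib)
  qed
qed

text \<open>
  Each summand lacks at most one of the factors that vanish at \<open>c\<close>.
\<close>

lemma secular_poly_dvd_pred:
  "[:- c, 1:] ^ (root_count {1..M} a c - 1) dvd secular_poly M a w"
  unfolding secular_poly_def
proof (intro dvd_diff dvd_sum dvd_smult)
  let ?k = "root_count {1..M} a c"
  show "[:- c, 1:] ^ (?k - 1) dvd root_poly {1..M} a"
    unfolding order_divides using order_root_poly[of "{1..M}" c a] by simp
  fix m assume "m \<in> {1..M}"
  have "{j\<in>{1..M}. a j = c} - {m} = {j\<in>{1..M} - {m}. a j = c}" by auto
  then have "?k - 1 \<le> root_count ({1..M} - {m}) a c"
    unfolding root_count_def by (simp only: flip: \<open>_ - {m} = _\<close>) (simp add: card_Diff_singleton_if)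
  then show "[:- c, 1:] ^ (?k - 1) dvd root_poly ({1..M} - {m}) a"
    unfolding order_divides using order_root_poly[of "{1..M} - {m}" c a] by simp
qed

text \<open>
  When the weights at \<open>c\<close> vanish, no summand loses a factor that vanishes at \<open>c\<close>. The cofactor at \<open>c\<close>
  is then the value there of the secular function without its removable singularity; a zero of that
  value raises the multiplicity of \<open>c\<close> by one.
\<close>

lemma secular_poly_factor:
  assumes "\<And>m. m \<in> {1..M} \<Longrightarrow> a m = c \<Longrightarrow> w m = 0"
  obtains h where "secular_poly M a w = [:- c, 1:] ^ root_count {1..M} a c * h"
    and "poly h c = poly (root_poly {m\<in>{1..M}. a m \<noteq> c} a) c *
      (1 - (\<Sum>m\<in>{m\<in>{1..M}. a m \<noteq> c}. w m / (c - a m)))"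
proof -
  let ?R = "{m\<in>{1..M}. a m \<noteq> c}" let ?k = "root_count {1..M} a c"
  let ?h = "root_poly ?R a - (\<Sum>m\<in>?R. smult (w m) (root_poly (?R - {m}) a))"
  show thesis
  proof (rule that[of ?h])
    have "(\<Sum>m\<in>{1..M}. smult (w m) (root_poly ({1..M} - {m}) a)) =
        (\<Sum>m\<in>?R. smult (w m) (root_poly ({1..M} - {m}) a))"
      using assms by (intro sum.mono_neutral_right) auto
    also have "\<dots> = (\<Sum>m\<in>?R. [:- c, 1:] ^ ?k * smult (w m) (root_poly (?R - {m}) a))"
    proof (rule sum.cong[OF refl])
      fix m assume m: "m \<in> ?R"
      have "{j\<in>{1..M} - {m}. a j = c} = {j\<in>{1..M}. a j = c}"
        "{j\<in>{1..M} - {m}. a j \<noteq> c} = ?R - {m}" using m by auto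
      then have "root_poly ({1..M} - {m}) a = [:- c, 1:] ^ ?k * root_poly (?R - {m}) a"
        using root_poly_factor[of "{1..M} - {m}" a c] by (simp add: root_count_def)
      then show "smult (w m) (root_poly ({1..M} - {m}) a) = [:- c, 1:] ^ ?k * smult (w m) (root_poly (?R - {m}) a)"
        by simp
    qed
    finally show "secular_poly M a w = [:- c, 1:] ^ ?k * ?h"
      unfolding secular_poly_def
      by (subst root_poly_factor[of "{1..M}" a c]) (simp_all only: right_diff_distrib sum_distrib_left finite_atLeastAtMost)
    have "poly (root_poly (?R - {m}) a) c = poly (root_poly ?R a) c / (c - a m)" if "m \<in> ?R" for m
      using that by (simp add: poly_root_poly prod_diff1)
    then have "(\<Sum>m\<in>?R. w m * poly (root_poly (?R - {m}) a) c) = poly (root_poly ?R a) c * (\<Sum>m\<in>?R. w m / (c - a m))"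
      by (subst sum_distrib_left) (intro sum.cong, auto)
    then show "poly ?h c = poly (root_poly ?R a) c * (1 - (\<Sum>m\<in>?R. w m / (c - a m)))"
      by (simp add: poly_sum right_diff_distrib)
  qed
qed

text \<open>
  Both polynomials are monic of degree \<open>M\<close>.
\<close>

lemma root_poly_eq_secular_poly:
  assumes "root_poly {1..M} g dvd secular_poly M a w"
  shows "root_poly {1..M} g = secular_poly M a w"
proof -
  let ?S = "\<Sum>m\<in>{1..M}. smult (w m) (root_poly ({1..M} - {m}) a)"
  let ?r = "secular_poly M a w - root_poly {1..M} g"
  have co: "coeff ?S M = 0"
    unfolding coeff_sum by (intro sum.neutral ballI) (auto simp: degree_root_poly intro!: coeff_eq_0)
  have deg: "degree ?S \<le> M"
    by (intro degree_sum_le) (auto intro: order.trans[OF degree_smult_le] simp: degree_root_poly)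
  have "?r = 0"
  proof (rule dvd_small_degree_eq_0)
    show "root_poly {1..M} g dvd ?r" using assms by simp
    show "degree ?r \<le> degree (root_poly {1..M} g)"
      unfolding secular_poly_def using deg by (intro degree_diff_le) (auto simp: degree_root_poly)
    show "coeff ?r (degree (root_poly {1..M} g)) = 0"
      using monic_root_poly[of "{1..M}" a] monic_root_poly[of "{1..M}" g] co
      by (simp add: secular_poly_def degree_root_poly)
  qed
  then show ?thesis by simp
qed

section \<open>Real and complex scalars\<close>

lemma conjg_0 [simp]: "conjg (0::'k::real_or_complex) = 0"
  using conjg_add[of "0::'k" 0] by simp

lemma conjg_of_real [simp]: "conjg (of_real r :: 'k::real_or_complex) = of_real r"
proof (cases "r = 0")
  case False
  have "of_real r * conjg (of_real r :: 'k) = of_real r * of_real r"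
    by (simp add: mult_conjg of_real_def power2_eq_square)
  with False show ?thesis by simp
qed simp

lemma mult_conjg_of_real: "(x::'k::real_or_complex) * conjg x = of_real ((norm x)\<^sup>2)"
  by (simp add: mult_conjg of_real_def)

lemma norm_conjg [simp]: "norm (conjg (x::'k::real_or_complex)) = norm x"
proof (cases "x = 0")
  case False
  have "norm x * norm (conjg x) = norm x * norm x"
    unfolding norm_mult[symmetric] mult_conjg_of_real by (simp add: norm_mult power2_eq_square)
  with False show ?thesis by simp
qed simp

text \<open>
  A self-conjugate scalar satisfies \<open>z\<^sup>2 = |z|\<^sup>2\<close>, hence is \<open>|z|\<close> or \<open>-|z|\<close>. This replaces real and
  imaginary parts, which an abstract scalar field does not offer.
\<close>

lemma self_conjugate_imp_real:
  assumes "conjg z = (z::'k::real_or_complex)"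
  shows "\<exists>r. z = of_real r"
proof -
  have "z * z = of_real (norm z) * of_real (norm z)"
    using mult_conjg_of_real[of z] assms by (simp add: power2_eq_square)
  then have "z = of_real (norm z) \<or> z = of_real (- norm z)"
    by (simp add: square_eq_iff)
  then show ?thesis by blast
qed

section \<open>Self-adjoint operators and orthonormal families\<close>

definition self_adjoint ::
  "('k::real_or_complex \<Rightarrow> 'v::ab_group_add \<Rightarrow> 'v) \<Rightarrow> ('v \<Rightarrow> 'v \<Rightarrow> 'k) \<Rightarrow> ('v \<Rightarrow> 'v) \<Rightarrow> bool"
  where "self_adjoint scl ip T \<longleftrightarrow>
    Vector_Spaces.linear scl scl T \<and> (\<forall>x y. ip (T x) y = ip x (T y))"

definition orthonormal_on :: "('v \<Rightarrow> 'v \<Rightarrow> 'k::real_or_complex) \<Rightarrow> nat set \<Rightarrow> (nat \<Rightarrow> 'v) \<Rightarrow> bool"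
  where "orthonormal_on ip I e \<longleftrightarrow> (\<forall>i\<in>I. \<forall>j\<in>I. ip (e i) (e j) = (if i = j then 1 else 0))"

text \<open>
  The real number that equals \<open>\<langle>T x, x\<rangle>\<close>. It exists if \<open>T\<close> is self-adjoint, because \<open>\<langle>T x, x\<rangle>\<close> is then
  its own conjugate.
\<close>

definition quad_form :: "('v \<Rightarrow> 'v \<Rightarrow> 'k::real_or_complex) \<Rightarrow> ('v \<Rightarrow> 'v) \<Rightarrow> 'v \<Rightarrow> real"
  where "quad_form ip T x = (THE r. of_real r = ip (T x) x)"

text \<open>
  The length \<open>n\<close> is kept apart from the dimension so that eigenbases can be built one vector at a time.
\<close>

definition eigenbasis ::
  "('k::real_or_complex \<Rightarrow> 'v::ab_group_add \<Rightarrow> 'v) \<Rightarrow> ('v \<Rightarrow> 'v \<Rightarrow> 'k) \<Rightarrow> nat \<Rightarrow>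
   ('v \<Rightarrow> 'v) \<Rightarrow> (nat \<Rightarrow> 'v) \<Rightarrow> (nat \<Rightarrow> real) \<Rightarrow> bool"
  where "eigenbasis scl ip n T e a \<longleftrightarrow> orthonormal_on ip {1..n} e \<and>
    (\<forall>m\<in>{1..n}. T (e m) = scl (of_real (a m)) (e m)) \<and> antimono_on {1..n} a"

lemma quad_form_eqI: "ip (T x) x = of_real r \<Longrightarrow> quad_form ip T x = r"
  unfolding quad_form_def by (rule the_equality) auto

context hilbert_space_dim
begin

abbreviation nsq :: "'v \<Rightarrow> real" where "nsq x \<equiv> norm (ip x x)"

lemma ip_add_right: "ip x (y + z) = ip x y + ip x z"
  using ip_commute ip_add_left conjg_add by metis

lemma ip_scale_right: "ip x (scl c y) = conjg c * ip x y"
  using ip_commute ip_scale_left conjg_mult by metis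

lemma ip_zero_left [simp]: "ip 0 x = 0"
  using ip_add_left[of 0 0 x] by simp

lemma ip_zero_right [simp]: "ip x 0 = 0"
  using ip_add_right[of x 0 0] by simp

lemma ip_diff_left: "ip (x - y) z = ip x z - ip y z"
  using ip_add_left[of "x - y" y z] by (simp add: algebra_simps)

lemma ip_diff_right: "ip z (x - y) = ip z x - ip z y"
  using ip_add_right[of z "x - y" y] by (simp add: algebra_simps)

lemma ip_sum_left: "ip (\<Sum>i\<in>I. f i) y = (\<Sum>i\<in>I. ip (f i) y)"
  by (induction I rule: infinite_finite_induct) (simp_all add: ip_add_left)

lemma ip_sum_right: "ip y (\<Sum>i\<in>I. f i) = (\<Sum>i\<in>I. ip y (f i))"
  by (induction I rule: infinite_finite_induct) (simp_all add: ip_add_right)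

lemma ip_self: "ip x x = of_real (nsq x)"
  using ip_nonneg[of x] by auto

lemma ip_eq_0_commute: "ip x y = 0 \<longleftrightarrow> ip y x = 0"
  using ip_commute conjg_0 by metis

lemma nsq_pos: "x \<noteq> 0 \<Longrightarrow> 0 < nsq x"
  using ip_definite by auto

lemma ip_commute_mult: "ip x y * ip y x = of_real ((norm (ip x y))\<^sup>2)"
  using mult_conjg_of_real[of "ip x y"] by (simp only: ip_commute[where x = x and y = y])

lemma norm_ip_commute: "norm (ip x y) = norm (ip y x)"
  by (metis ip_commute norm_conjg)

lemma linear_iff_scl:
  "Vector_Spaces.linear scl scl T \<longleftrightarrow> (\<forall>x y. T (x + y) = T x + T y) \<and> (\<forall>c x. T (scl c x) = scl c (T x))"
  by (simp add: Vector_Spaces.linear_iff vector_space_axioms)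

lemma quad_form:
  assumes "self_adjoint scl ip T"
  shows "ip (T x) x = of_real (quad_form ip T x)"
proof -
  have "conjg (ip (T x) x) = ip (T x) x"
    using assms ip_commute[of x "T x"] unfolding self_adjoint_def by metis
  then obtain r where "ip (T x) x = of_real r" using self_conjugate_imp_real by blast
  then show ?thesis using quad_form_eqI[of ip T x r] by simp
qed

lemma orthonormal_sum:
  assumes "orthonormal_on ip I e" "finite I" "j \<in> I"
  shows "ip (\<Sum>i\<in>I. scl (c i) (e i)) (e j) = c j"
proof -
  have "ip (\<Sum>i\<in>I. scl (c i) (e i)) (e j) = (\<Sum>i\<in>I. if i = j then c i else 0)"
    unfolding ip_sum_left
    using assms by (intro sum.cong) (auto simp: ip_scale_left orthonormal_on_def)
  then show ?thesis using assms by simp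
qed

lemma orthonormal_inj: "orthonormal_on ip I e \<Longrightarrow> inj_on e I"
  unfolding orthonormal_on_def inj_on_def by (metis zero_neq_one)

lemma orthonormal_independent:
  assumes "orthonormal_on ip I e" "finite I"
  shows "independent (e ` I)"
proof (rule independent_if_scalars_zero)
  fix f x assume s: "(\<Sum>x\<in>e ` I. scl (f x) x) = 0" and "x \<in> e ` I"
  then obtain j where j: "j \<in> I" "x = e j" by auto
  have "(\<Sum>i\<in>I. scl (f (e i)) (e i)) = 0"
    using s orthonormal_inj[OF assms(1)] by (simp add: sum.reindex)
  then show "f x = 0"
    using orthonormal_sum[OF assms j(1), of "\<lambda>i. f (e i)"] j by simp
qed (use assms in simp)

lemma independent_basis:
  obtains B where "finite_dimensional_vector_space scl B" "card B = M"
proof -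
  obtain B where B: "independent B" "UNIV \<subseteq> span B" "card B = dim UNIV"
    using basis_exists[of UNIV] by metis
  obtain B0 where "finite B0" "span B0 = UNIV" using finite_dim by blast
  then have "finite B" using independent_span_bound[of B0 B] B by auto
  then have "finite_dimensional_vector_space scl B"
    using B by unfold_locales auto
  then show thesis using that B dim_space by simp
qed

text \<open>
  Fewer than \<open>M\<close> linear equations have a nontrivial solution. The equations are packed into an
  endomorphism by attaching to them distinct basis vectors; it misses a dimension, so it is not
  injective.
\<close>

lemma exists_orthogonal_vector:
  assumes "finite G" "card G < M"
  shows "\<exists>x. x \<noteq> 0 \<and> (\<forall>y\<in>G. ip x y = 0)"
proof -
  obtain B where fd: "finite_dimensional_vector_space scl B" and B: "card B = M"
    by (rule independent_basis)
  interpret fd: finite_dimensional_vector_space scl B by (rule fd)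
  obtain \<phi> where \<phi>: "\<phi> ` G \<subseteq> B" "inj_on \<phi> G"
    using card_le_inj[OF assms(1) fd.finite_Basis] assms(2) B by auto
  define L where "L x = (\<Sum>y\<in>G. scl (ip x y) (\<phi> y))" for x
  have lin: "Vector_Spaces.linear scl scl L"
    unfolding linear_iff_scl L_def
    by (simp add: ip_add_left ip_scale_left scale_left_distrib sum.distrib scale_sum_right)
  have "L x \<in> span (\<phi> ` G)" for x
    unfolding L_def by (intro span_sum span_scale span_base imageI)
  then have "range L \<subseteq> span (\<phi> ` G)" by blast
  then have "dim (range L) \<le> card (\<phi> ` G)" using assms(1) by (intro dim_le_card) auto
  also have "\<dots> < M" using \<phi>(2) assms(2) by (simp add: card_image)
  finally have "\<not> surj L" using dim_space by auto
  then have "\<not> inj L" using fd.linear_inj_imp_surj[OF lin] by blast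
  then obtain x where x: "L x = 0" "x \<noteq> 0"
    using lin unfolding Vector_Spaces.linear_def by (metis module_hom.inj_iff_eq_0)
  have "(\<Sum>b\<in>\<phi> ` G. scl (ip x (inv_into G \<phi> b)) b) = 0"
    using x(1) \<phi>(2) by (simp add: sum.reindex L_def)
  then have "ip x (inv_into G \<phi> b) = 0" if "b \<in> \<phi> ` G" for b
    using fd.independent_Basis \<phi>(1) assms(1) that
    by (intro independentD[of B "\<phi> ` G" "\<lambda>b. ip x (inv_into G \<phi> b)" b]) auto
  then have "ip x y = 0" if "y \<in> G" for y
    using that \<phi>(2) by (metis imageI inv_into_f_f)
  then show ?thesis using x(2) by blast
qed

lemma normalized_vector:
  assumes "x \<noteq> 0"
  obtains r where "ip (scl (of_real r) x) (scl (of_real r) x) = 1"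
proof (rule that[of "1 / sqrt (nsq x)"])
  have "0 < nsq x" using nsq_pos[OF assms] .
  have "ip (scl (of_real (1 / sqrt (nsq x))) x) (scl (of_real (1 / sqrt (nsq x))) x)
      = of_real (1 / sqrt (nsq x)) * (of_real (1 / sqrt (nsq x)) * of_real (nsq x))"
    by (simp only: ip_scale_left ip_scale_right conjg_of_real ip_self[symmetric])
  also have "\<dots> = of_real ((1 / sqrt (nsq x)) * ((1 / sqrt (nsq x)) * nsq x))"
    by (simp only: of_real_mult)
  also have "(1 / sqrt (nsq x)) * ((1 / sqrt (nsq x)) * nsq x) = 1"
    using \<open>0 < nsq x\<close> by (simp add: field_simps)
  finally show "ip (scl (of_real (1 / sqrt (nsq x))) x) (scl (of_real (1 / sqrt (nsq x))) x) = 1"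
    by simp
qed

lemma orthonormal_extend:
  assumes "orthonormal_on ip {1..k} e" "\<And>i. i \<in> {1..k} \<Longrightarrow> ip u (e i) = 0" "ip u u = 1"
  shows "orthonormal_on ip {1..Suc k} (e(Suc k := u))"
  using assms ip_eq_0_commute unfolding orthonormal_on_def
  by (auto simp: le_Suc_eq)

lemma orthonormal_exists: "k \<le> M \<Longrightarrow> \<exists>e. orthonormal_on ip {1..k} e"
proof (induction k)
  case 0
  then show ?case by (simp add: orthonormal_on_def)
next
  case (Suc k)
  then obtain e where e: "orthonormal_on ip {1..k} e" by auto
  have "card (e ` {1..k}) < M" using card_image_le[of "{1..k}" e] Suc.prems by simp
  then obtain x where x: "x \<noteq> 0" "\<forall>y\<in>e ` {1..k}. ip x y = 0"
    using exists_orthogonal_vector[of "e ` {1..k}"] by auto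
  obtain r where r: "ip (scl (of_real r) x) (scl (of_real r) x) = 1"
    using normalized_vector[OF x(1)] by blast
  show ?case
    using orthonormal_extend[OF e _ r] x(2) by (auto simp: ip_scale_left)
qed

lemma orthonormal_expansion:
  assumes "orthonormal_on ip {1..M} e"
  shows "x = (\<Sum>i\<in>{1..M}. scl (ip x (e i)) (e i))"
proof -
  obtain B where fd: "finite_dimensional_vector_space scl B" and B: "card B = M"
    by (rule independent_basis)
  interpret fd: finite_dimensional_vector_space scl B by (rule fd)
  have card: "card (e ` {1..M}) = M"
    using orthonormal_inj[OF assms] by (simp add: card_image)
  have "UNIV \<subseteq> span (e ` {1..M})"
    using fd.card_ge_dim_independent[of "e ` {1..M}" UNIV] orthonormal_independent[OF assms] card dim_space
    by simp
  then have "x \<in> range (\<lambda>c. \<Sum>v\<in>e ` {1..M}. scl (c v) v)"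
    by (subst span_finite[symmetric]) auto
  then obtain c where "x = (\<Sum>v\<in>e ` {1..M}. scl (c v) v)" by auto
  then have x: "x = (\<Sum>i\<in>{1..M}. scl (c (e i)) (e i))"
    using orthonormal_inj[OF assms] by (simp add: sum.reindex)
  then have "ip x (e j) = c (e j)" if "j \<in> {1..M}" for j
    using orthonormal_sum[OF assms _ that, of "\<lambda>i. c (e i)"] by simp
  then show ?thesis using x by simp
qed

lemma orthonormal_ip:
  assumes "orthonormal_on ip {1..M} e"
  shows "ip x y = (\<Sum>i\<in>{1..M}. ip x (e i) * ip (e i) y)"
  by (subst orthonormal_expansion[OF assms, of x]) (simp add: ip_sum_left ip_scale_left)

lemma orthonormal_nsq:
  assumes "orthonormal_on ip {1..M} e"
  shows "nsq x = (\<Sum>i\<in>{1..M}. (norm (ip x (e i)))\<^sup>2)"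
proof -
  have "of_real (nsq x) = (of_real (\<Sum>i\<in>{1..M}. (norm (ip x (e i)))\<^sup>2) :: 'k)"
    unfolding ip_self[symmetric] of_real_sum
    by (subst orthonormal_ip[OF assms]) (simp only: ip_commute_mult)
  then show ?thesis by (simp only: of_real_eq_iff)
qed

lemma orthonormal_eqI:
  assumes "orthonormal_on ip {1..M} e" "\<And>i. i \<in> {1..M} \<Longrightarrow> ip x (e i) = ip y (e i)"
  shows "x = y"
proof -
  have "x = (\<Sum>i\<in>{1..M}. scl (ip x (e i)) (e i))" by (rule orthonormal_expansion[OF assms(1)])
  also have "\<dots> = (\<Sum>i\<in>{1..M}. scl (ip y (e i)) (e i))" using assms(2) by simp
  also have "\<dots> = y" by (rule orthonormal_expansion[OF assms(1), symmetric])
  finally show ?thesis .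
qed

section \<open>The spectral theorem\<close>

text \<open>
  Expanding in an orthonormal basis bounds the form by the sum of the moduli of its matrix entries.
\<close>

lemma linear_form_bounded:
  assumes "Vector_Spaces.linear scl scl S"
  shows "\<exists>C>0. \<forall>x. norm (ip (S x) x) \<le> C * nsq x"
proof -
  obtain e where e: "orthonormal_on ip {1..M} e" using orthonormal_exists by blast
  interpret S: Vector_Spaces.linear scl scl S by (rule assms)
  let ?K = "\<Sum>i\<in>{1..M}. \<Sum>j\<in>{1..M}. norm (ip (S (e i)) (e j))"
  have coef: "norm (ip x (e i)) \<le> sqrt (nsq x)" if "i \<in> {1..M}" for x i
  proof (rule real_le_rsqrt)
    show "(norm (ip x (e i)))\<^sup>2 \<le> nsq x"
      unfolding orthonormal_nsq[OF e, of x] using that by (intro member_le_sum) auto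
  qed
  have "norm (ip (S x) x) \<le> ?K * nsq x" for x
  proof -
    have "S x = (\<Sum>i\<in>{1..M}. scl (ip x (e i)) (S (e i)))"
      by (subst orthonormal_expansion[OF e, of x]) (simp add: S.sum S.scale)
    then have "ip (S x) x = (\<Sum>i\<in>{1..M}. ip x (e i) * ip (S (e i)) x)"
      by (simp add: ip_sum_left ip_scale_left)
    also have "\<dots> = (\<Sum>i\<in>{1..M}. \<Sum>j\<in>{1..M}. ip x (e i) * (ip (S (e i)) (e j) * ip (e j) x))"
      by (subst orthonormal_ip[OF e, of "S _" x]) (simp add: sum_distrib_left)
    finally have "norm (ip (S x) x)
        \<le> (\<Sum>i\<in>{1..M}. \<Sum>j\<in>{1..M}. norm (ip x (e i) * (ip (S (e i)) (e j) * ip (e j) x)))"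
      by (auto intro!: order.trans[OF norm_sum] sum_mono)
    also have "\<dots> \<le> (\<Sum>i\<in>{1..M}. \<Sum>j\<in>{1..M}. norm (ip (S (e i)) (e j)) * nsq x)"
    proof (intro sum_mono)
      fix i j assume ij: "i \<in> {1..M}" "j \<in> {1..M}"
      have "norm (ip x (e i)) * norm (ip x (e j)) \<le> sqrt (nsq x) * sqrt (nsq x)"
        by (intro mult_mono coef ij) auto
      then have "norm (ip (S (e i)) (e j)) * (norm (ip x (e i)) * norm (ip x (e j)))
          \<le> norm (ip (S (e i)) (e j)) * nsq x"
        by (intro mult_left_mono) auto
      then show "norm (ip x (e i) * (ip (S (e i)) (e j) * ip (e j) x)) \<le> norm (ip (S (e i)) (e j)) * nsq x"
        by (simp add: norm_mult norm_ip_commute[of "e j" x] ac_simps)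
    qed
    finally show ?thesis by (simp add: sum_distrib_right)
  qed
  moreover have "?K * nsq x \<le> (?K + 1) * nsq x" for x by (simp add: distrib_right)
  moreover have "0 < ?K + 1" by (intro add_nonneg_pos sum_nonneg) auto
  ultimately show ?thesis by (meson order.trans)
qed

lemma abs_quad_form: "self_adjoint scl ip T \<Longrightarrow> \<bar>quad_form ip T x\<bar> = norm (ip (T x) x)"
  by (simp add: quad_form)

text \<open>
  Let \<open>l\<close> be the supremum of the Rayleigh quotient, so that \<open>S = l - T\<close> is positive semidefinite. If \<open>S\<close>
  had no kernel, it would have an inverse \<open>G\<close> with \<open>\<langle>G w, w\<rangle> \<le> D |w|\<^sup>2\<close>. Positivity of \<open>S\<close> then yields
  \<open>\<langle>S w, w\<rangle> \<ge> |w|\<^sup>2 / D\<close>, so the Rayleigh quotient stays below \<open>l - 1 / D\<close>, which contradicts the choice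
  of \<open>l\<close>.
\<close>

lemma top_eigenvector:
  assumes sa: "self_adjoint scl ip T" and "0 < M"
  shows "\<exists>l u. u \<noteq> 0 \<and> T u = scl (of_real l) u \<and> (\<forall>x. quad_form ip T x \<le> l * nsq x)"
proof -
  have lin: "Vector_Spaces.linear scl scl T" and adj: "\<And>x y. ip (T x) y = ip x (T y)"
    using sa unfolding self_adjoint_def by auto
  let ?R = "{quad_form ip T x / nsq x |x. x \<noteq> 0}"
  obtain C where C: "\<And>x. norm (ip (T x) x) \<le> C * nsq x" using linear_form_bounded[OF lin] by blast
  have "quad_form ip T x \<le> C * nsq x" for x
    using abs_quad_form[OF sa, of x] C[of x] by linarith
  then have "quad_form ip T x / nsq x \<le> C" if "x \<noteq> 0" for x
    using nsq_pos[OF that] by (simp add: divide_le_eq)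
  then have bdd: "bdd_above ?R" by (intro bdd_aboveI[of _ C]) blast
  have "\<exists>z. z \<noteq> 0 \<and> (\<forall>y\<in>{}. ip z y = 0)"
    using assms(2) by (intro exists_orthogonal_vector) simp_all
  then obtain z :: 'v where "z \<noteq> 0" by blast
  then have ne: "?R \<noteq> {}" by auto
  define l where "l = Sup ?R"
  have le: "quad_form ip T x \<le> l * nsq x" for x
  proof (cases "x = 0")
    case True
    have "quad_form ip T x = 0" by (rule quad_form_eqI) (simp add: True)
    then show ?thesis by (simp add: True)
  next
    case False
    then have "quad_form ip T x / nsq x \<le> l"
      unfolding l_def using bdd by (intro cSup_upper) auto
    then show ?thesis using nsq_pos[OF False] by (simp add: divide_le_eq)
  qed
  define S where "S x = scl (of_real l) x - T x" for x
  have linS: "Vector_Spaces.linear scl scl S"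
    using lin unfolding linear_iff_scl S_def
    by (simp add: scale_right_distrib scale_right_diff_distrib scale_left_commute)
  have adjS: "ip (S x) y = ip x (S y)" for x y
    unfolding S_def by (simp only: ip_diff_left ip_diff_right ip_scale_left ip_scale_right adj conjg_of_real)
  have formS: "ip (S x) x = of_real (l * nsq x - quad_form ip T x)" for x
    unfolding S_def ip_diff_left ip_scale_left quad_form[OF sa, of x] of_real_diff of_real_mult
      ip_self[symmetric] ..
  have "\<exists>u. u \<noteq> 0 \<and> S u = 0"
  proof (rule ccontr)
    assume "\<not> ?thesis"
    then have "inj S"
      using linS unfolding Vector_Spaces.linear_def by (metis module_hom.inj_iff_eq_0)
    moreover obtain B where fd: "finite_dimensional_vector_space scl B"
      by (rule independent_basis)
    interpret fd: finite_dimensional_vector_space scl B by (rule fd)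
    interpret p: vector_space_pair scl scl by unfold_locales
    have "surj S" using fd.linear_inj_imp_surj[OF linS \<open>inj S\<close>] .
    then obtain G where linG: "Vector_Spaces.linear scl scl G" and SG: "S \<circ> G = id"
      using p.linear_surjective_right_inverse[OF linS] by blast
    obtain D where D: "D > 0" "\<And>x. norm (ip (G x) x) \<le> D * nsq x"
      using linear_form_bounded[OF linG] by blast
    have "quad_form ip T w \<le> (l - 1 / D) * nsq w" for w
    proof -
      define v where "v = G w"
      define s where "s = l * nsq w - quad_form ip T w"
      define q where "q = l * nsq v - quad_form ip T v"
      \<comment> \<open>The form of S is nonnegative at d; since S v = w, it equals
        \<open>\<langle>w, v\<rangle> - 2 D |w|\<^sup>2 + D\<^sup>2 \<langle>S w, w\<rangle>\<close> there, which gives the lower bound for \<open>\<langle>S w, w\<rangle>\<close>.\<close>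
      define d where "d = v - scl (of_real D) w"
      have Sv: "S v = w" unfolding v_def using SG by (metis comp_apply id_apply)
      have q: "ip w v = of_real q" using formS[of v] Sv by (simp only: q_def)
      have s: "ip (S w) w = of_real s" unfolding s_def by (rule formS)
      obtain n where n: "n = nsq w" by simp
      have ww: "ip w w = of_real n" unfolding n by (rule ip_self)
      have "\<bar>q\<bar> = norm (ip (G w) w)"
        unfolding v_def[symmetric] norm_ip_commute[of v w] q norm_of_real ..
      then have "\<bar>q\<bar> \<le> D * n" using D(2)[of w] n by simp
      have "S d = w - scl (of_real D) (S w)"
        by (simp only: d_def module_hom.diff[OF linS[unfolded module_hom_iff_linear[symmetric]]]
          module_hom.scale[OF linS[unfolded module_hom_iff_linear[symmetric]]] Sv)
      then have "ip (S d) d = ip (w - scl (of_real D) (S w)) (v - scl (of_real D) w)"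
        by (simp only: d_def)
      also have "\<dots> = ip w v - of_real D * ip (S w) v - (of_real D * ip w w - of_real D * (of_real D * ip (S w) w))"
        by (simp only: ip_diff_left ip_diff_right ip_scale_left ip_scale_right conjg_of_real right_diff_distrib)
      also have "ip (S w) v = ip w w" by (simp only: adjS Sv)
      also have "ip w v - of_real D * ip w w - (of_real D * ip w w - of_real D * (of_real D * ip (S w) w))
          = of_real (q - D * n - (D * n - D * (D * s)))"
        by (simp only: q s ww of_real_diff of_real_mult)
      finally have "q - D * n - (D * n - D * (D * s)) = l * nsq d - quad_form ip T d"
        unfolding formS of_real_eq_iff by (rule sym)
      then have "0 \<le> q - D * n - (D * n - D * (D * s))"
        using le[of d] by linarith
      with \<open>\<bar>q\<bar> \<le> D * n\<close> have "D * n \<le> D * (D * s)" by linarith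
      then have "n \<le> D * s" using D(1) by simp
      then have "n / D \<le> s" using D(1) by (simp add: divide_le_eq mult.commute)
      then show ?thesis unfolding s_def n by (simp add: left_diff_distrib)
    qed
    then have "quad_form ip T x / nsq x \<le> l - 1 / D" if "x \<noteq> 0" for x
      using nsq_pos[OF that] by (simp add: divide_le_eq)
    then have "r \<le> l - 1 / D" if "r \<in> ?R" for r using that by blast
    then have "Sup ?R \<le> l - 1 / D" by (rule cSup_least[OF ne])
    then show False using D(1) by (simp add: l_def[symmetric])
  qed
  then obtain u where "u \<noteq> 0" "T u = scl (of_real l) u"
    unfolding S_def by (metis eq_iff_diff_eq_0)
  then show ?thesis using le by blast
qed

text \<open>
  Eigenvectors are found in order of decreasing eigenvalue, each maximising the Rayleigh quotient on the
  orthogonal complement of the previous ones. The second conjunct records this maximality, from which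
  monotonicity of the eigenvalues follows.
\<close>

lemma partial_eigenbasis_exists:
  assumes sa: "self_adjoint scl ip T"
  shows "k \<le> M \<Longrightarrow> \<exists>e a. eigenbasis scl ip k T e a \<and>
    (\<forall>x. (\<forall>i\<in>{1..k}. ip x (e i) = 0) \<longrightarrow> (\<forall>i\<in>{1..k}. quad_form ip T x \<le> a i * nsq x))"
proof (induction k)
  case 0
  then show ?case by (simp add: eigenbasis_def orthonormal_on_def monotone_on_def)
next
  case (Suc k)
  then have "k \<le> M" by simp
  from Suc.IH[OF this] obtain e a where eb: "eigenbasis scl ip k T e a"
    and IH: "\<forall>x. (\<forall>i\<in>{1..k}. ip x (e i) = 0) \<longrightarrow> (\<forall>i\<in>{1..k}. quad_form ip T x \<le> a i * nsq x)"
    by blast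
  have bound: "quad_form ip T x \<le> a i * nsq x"
    if "\<And>i. i \<in> {1..k} \<Longrightarrow> ip x (e i) = 0" "i \<in> {1..k}" for x i
    using IH that by blast
  have lin: "Vector_Spaces.linear scl scl T" and adj: "\<And>x y. ip (T x) y = ip x (T y)"
    using sa unfolding self_adjoint_def by auto
  have on: "orthonormal_on ip {1..k} e" and ev: "\<And>i. i \<in> {1..k} \<Longrightarrow> T (e i) = scl (of_real (a i)) (e i)"
    and mono: "antimono_on {1..k} a"
    using eb unfolding eigenbasis_def by auto
  have "card (e ` {1..k}) < M" using card_image_le[of "{1..k}" e] Suc.prems by simp
  then obtain w where w: "w \<noteq> 0" "\<And>i. i \<in> {1..k} \<Longrightarrow> ip w (e i) = 0"
    using exists_orthogonal_vector[of "e ` {1..k}"] by auto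
  obtain C where C: "\<And>x. norm (ip (T x) x) \<le> C * nsq x" using linear_form_bounded[OF lin] by blast
  \<comment> \<open>Subtracting P moves the eigenvalues found so far to -C - 1, below all values of the Rayleigh
    quotient of T. A top eigenvector of T - P is therefore orthogonal to their eigenvectors, which
    avoids restricting T to a subspace.\<close>
  define P where "P x = (\<Sum>i\<in>{1..k}. scl (of_real (a i + C + 1)) (scl (ip x (e i)) (e i)))" for x
  define T' where "T' x = T x - P x" for x
  have P0: "P x = 0" if "\<And>i. i \<in> {1..k} \<Longrightarrow> ip x (e i) = 0" for x
    using that unfolding P_def by simp
  have sa': "self_adjoint scl ip T'"
    unfolding self_adjoint_def
  proof (intro conjI allI)
    show "Vector_Spaces.linear scl scl T'"
      using lin unfolding linear_iff_scl T'_def P_def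
      by (simp add: ip_add_left ip_scale_left scale_left_distrib scale_right_distrib sum.distrib
          scale_right_diff_distrib scale_sum_right scale_left_commute mult.left_commute)
    fix x y
    have "ip (P x) y = ip x (P y)"
      unfolding P_def ip_sum_left ip_sum_right ip_scale_left ip_scale_right conjg_of_real
    proof (rule sum.cong[OF refl])
      fix i
      show "of_real (a i + C + 1) * (ip x (e i) * ip (e i) y) =
          of_real (a i + C + 1) * (conjg (ip y (e i)) * ip x (e i))"
        unfolding ip_commute[where x = y and y = "e i"] by (simp only: mult.commute)
    qed
    then show "ip (T' x) y = ip x (T' y)"
      unfolding T'_def by (simp add: ip_diff_left ip_diff_right adj)
  qed
  have "0 < M" using Suc.prems by simp
  then obtain l v where v: "v \<noteq> 0" "T' v = scl (of_real l) v"
    and top: "\<And>x. quad_form ip T' x \<le> l * nsq x"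
    using top_eigenvector[OF sa'] by blast
  have quad': "quad_form ip T' x = quad_form ip T x" if "\<And>i. i \<in> {1..k} \<Longrightarrow> ip x (e i) = 0" for x
    using P0[OF that] by (simp add: quad_form_def T'_def)
  have "- C * nsq w \<le> l * nsq w"
    using C[of w] top[of w] quad'[OF w(2)] abs_quad_form[OF sa, of w] by linarith
  then have lC: "- C \<le> l" using nsq_pos[OF w(1)] by (simp only: mult_le_cancel_right_pos)
  have orth: "ip v (e j) = 0" if j: "j \<in> {1..k}" for j
  proof -
    have "P (e j) = (\<Sum>i\<in>{1..k}. if i = j then scl (of_real (a i + C + 1)) (e i) else 0)"
      unfolding P_def using on j by (intro sum.cong) (auto simp: orthonormal_on_def)
    then have "P (e j) = scl (of_real (a j + C + 1)) (e j)" using j by simp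
    then have "T' (e j) = scl (of_real (a j - (a j + C + 1))) (e j)"
      by (simp only: T'_def ev[OF j] scale_left_diff_distrib of_real_diff)
    also have "a j - (a j + C + 1) = - C - 1" by simp
    finally have "T' (e j) = scl (of_real (- C - 1)) (e j)" .
    then have "ip (T' v) (e j) = of_real (- C - 1) * ip v (e j)"
      using sa' unfolding self_adjoint_def by (simp add: ip_scale_right conjg_of_real del: of_real_diff of_real_minus)
    then have "of_real l * ip v (e j) = of_real (- C - 1) * ip v (e j)"
      by (simp only: v(2) ip_scale_left)
    moreover have "(of_real l :: 'k) \<noteq> of_real (- C - 1)"
      unfolding of_real_eq_iff using lC by linarith
    ultimately show ?thesis by (simp only: mult_cancel_right) blast
  qed
  then have Tv: "T v = scl (of_real l) v" using v(2) P0[of v] by (simp add: T'_def)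
  obtain r where r: "ip (scl (of_real r) v) (scl (of_real r) v) = 1"
    using normalized_vector[OF v(1)] by blast
  define u where "u = scl (of_real r) v"
  have u: "ip u u = 1" "\<And>i. i \<in> {1..k} \<Longrightarrow> ip u (e i) = 0"
    using r orth by (auto simp: u_def ip_scale_left)
  have Tu: "T u = scl (of_real l) u"
    using lin Tv unfolding linear_iff_scl u_def by (simp add: scale_left_commute mult.commute)
  have "quad_form ip T u = l"
    by (rule quad_form_eqI) (simp add: Tu ip_scale_left u)
  then have la: "l \<le> a i" if "i \<in> {1..k}" for i
    using bound[OF u(2) that] u(1) by simp
  let ?e = "e(Suc k := u)" and ?a = "a(Suc k := l)"
  have "orthonormal_on ip {1..Suc k} ?e" by (rule orthonormal_extend[OF on u(2) u(1)])
  moreover have "T (?e m) = scl (of_real (?a m)) (?e m)" if "m \<in> {1..Suc k}" for m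
    using that ev Tu by (cases "m = Suc k") auto
  moreover have "antimono_on {1..Suc k} ?a"
    using mono la by (auto simp: monotone_on_def le_Suc_eq)
  moreover have "quad_form ip T x \<le> ?a i * nsq x"
    if x: "\<forall>i\<in>{1..Suc k}. ip x (?e i) = 0" and i: "i \<in> {1..Suc k}" for x i
  proof -
    have x': "ip x (e i) = 0" if "i \<in> {1..k}" for i
      using x that by (metis atLeastAtMost_iff fun_upd_apply le_Suc_eq not_less_eq_eq)
    show ?thesis
    proof (cases "i = Suc k")
      case True
      then show ?thesis using top[of x] quad'[OF x'] by simp
    next
      case False
      then show ?thesis using bound[OF x', of i] i by simp
    qed
  qed
  ultimately show ?case unfolding eigenbasis_def by blast
qed

lemma eigenbasis_exists:
  "self_adjoint scl ip T \<Longrightarrow> \<exists>e a. eigenbasis scl ip M T e a"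
  using partial_eigenbasis_exists[of T M] by blast

section \<open>Spectra and eigenspaces\<close>

lemma eigenbasis_coord:
  assumes "eigenbasis scl ip M T e a" "self_adjoint scl ip T" "m \<in> {1..M}"
  shows "ip (T x) (e m) = of_real (a m) * ip x (e m)"
  using assms unfolding eigenbasis_def self_adjoint_def by (simp add: ip_scale_right)

lemma eigenspace_eigenbasis:
  assumes eb: "eigenbasis scl ip M T e a" and sa: "self_adjoint scl ip T"
  shows "x \<in> eigenspace scl T c \<longleftrightarrow> (\<forall>m\<in>{1..M}. of_real (a m) \<noteq> c \<longrightarrow> ip x (e m) = 0)"
proof -
  have on: "orthonormal_on ip {1..M} e" using eb by (simp add: eigenbasis_def)
  have "x \<in> eigenspace scl T c \<longleftrightarrow> scl c x = T x" by (simp add: eigenspace_def)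
  also have "\<dots> \<longleftrightarrow> (\<forall>m\<in>{1..M}. ip (scl c x) (e m) = ip (T x) (e m))"
    using orthonormal_eqI[OF on, of "scl c x" "T x"] by auto
  also have "\<dots> \<longleftrightarrow> (\<forall>m\<in>{1..M}. c * ip x (e m) = of_real (a m) * ip x (e m))"
    using eigenbasis_coord[OF eb sa] by (simp add: ip_scale_left)
  finally show ?thesis by auto
qed

lemma eigenspace_subspace:
  assumes "self_adjoint scl ip T"
  shows "subspace (eigenspace scl T c)"
proof (rule subspaceI)
  have add: "T (x + y) = T x + T y" and scale: "T (scl k x) = scl k (T x)" for x y k
    using assms unfolding self_adjoint_def linear_iff_scl by auto
  show "0 \<in> eigenspace scl T c" using scale[of 0 0] by (simp add: eigenspace_def)
  show "x + y \<in> eigenspace scl T c" if "x \<in> eigenspace scl T c" "y \<in> eigenspace scl T c" for x y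
    using that by (simp add: eigenspace_def add scale_right_distrib)
  show "scl k x \<in> eigenspace scl T c" if "x \<in> eigenspace scl T c" for k x
    using that scale_left_commute[of c k x] by (simp add: eigenspace_def scale del: scale_scale)
qed

lemma dim_eigenspace:
  assumes eb: "eigenbasis scl ip M T e a" and sa: "self_adjoint scl ip T"
  shows "dim (eigenspace scl T c) = card {m\<in>{1..M}. of_real (a m) = c}"
proof -
  let ?I = "{m\<in>{1..M}. of_real (a m) = c}"
  have on: "orthonormal_on ip {1..M} e" using eb by (simp add: eigenbasis_def)
  then have onI: "orthonormal_on ip ?I e" by (auto simp: orthonormal_on_def)
  have "eigenspace scl T c = span (e ` ?I)"
  proof (intro equalityI subsetI)
    fix x assume x: "x \<in> eigenspace scl T c"
    have "x = (\<Sum>i\<in>{1..M}. scl (ip x (e i)) (e i))" by (rule orthonormal_expansion[OF on])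
    also have "\<dots> = (\<Sum>i\<in>?I. scl (ip x (e i)) (e i))"
      using x unfolding eigenspace_eigenbasis[OF eb sa] by (intro sum.mono_neutral_right) auto
    also have "\<dots> \<in> span (e ` ?I)" by (intro span_sum span_scale span_base imageI)
    finally show "x \<in> span (e ` ?I)" .
  next
    fix x assume "x \<in> span (e ` ?I)"
    moreover have "e ` ?I \<subseteq> eigenspace scl T c"
      using eb by (auto simp: eigenspace_def eigenbasis_def)
    ultimately show "x \<in> eigenspace scl T c"
      using span_minimal[OF _ eigenspace_subspace[OF sa]] by blast
  qed
  also have "dim (span (e ` ?I)) = card (e ` ?I)"
    using orthonormal_independent[OF onI] by (intro dim_span_eq_card_independent) simp
  also have "\<dots> = card ?I" using orthonormal_inj[OF onI] by (rule card_image)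
  finally show ?thesis .
qed

lemma eigenbasis_is_spectrum:
  assumes "eigenbasis scl ip M T e a" "self_adjoint scl ip T"
  shows "is_spectrum scl T M a"
  using assms dim_eigenspace[OF assms] by (simp add: is_spectrum_def eigenbasis_def)

lemma root_count_is_spectrum:
  assumes "is_spectrum scl T M a"
  shows "root_count {1..M} a c = dim (eigenspace scl T (of_real c))"
proof -
  have "card {m\<in>{1..M}. of_real (a m) = (of_real c :: 'k)} = dim (eigenspace scl T (of_real c))"
    using assms unfolding is_spectrum_def by blast
  then show ?thesis by (simp only: root_count_def of_real_eq_iff)
qed

lemma is_spectrum_unique:
  assumes "is_spectrum scl T M a" "is_spectrum scl T M b" "m \<in> {1..M}"
  shows "a m = b m"
proof (rule antimono_root_count_unique[OF _ _ _ assms(3)])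
  show "root_count {1..M} a = root_count {1..M} b"
    using root_count_is_spectrum[OF assms(1)] root_count_is_spectrum[OF assms(2)] by (intro ext) simp
qed (use assms in \<open>simp_all add: is_spectrum_def\<close>)

lemma is_spectrum_cong:
  assumes "is_spectrum scl T M a" "\<And>m. m \<in> {1..M} \<Longrightarrow> a m = b m"
  shows "is_spectrum scl T M b"
proof -
  have "{m\<in>{1..M}. of_real (b m) = c} = {m\<in>{1..M}. of_real (a m) = c}" for c :: 'k
    using assms(2) by auto
  moreover have "antimono_on {1..M} b"
    using assms unfolding is_spectrum_def monotone_on_def by simp
  ultimately show ?thesis using assms(1) unfolding is_spectrum_def by simp
qed

text \<open>
  The projection onto an eigenspace keeps exactly the coordinates whose eigenvalue is \<open>l\<close>.
\<close>

lemma hnorm_orth_proj_eigenspace: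
  assumes eb: "eigenbasis scl ip M T e a" and sa: "self_adjoint scl ip T"
  shows "(hnorm ip (orth_proj ip (eigenspace scl T (of_real l)) x))\<^sup>2 =
    (\<Sum>m\<in>{m\<in>{1..M}. a m = l}. (norm (ip x (e m)))\<^sup>2)"
proof -
  let ?I = "{m\<in>{1..M}. a m = l}" and ?E = "eigenspace scl T (of_real l)"
  define p where "p = (\<Sum>m\<in>{1..M}. scl (if a m = l then ip x (e m) else 0) (e m))"
  have on: "orthonormal_on ip {1..M} e" using eb by (simp add: eigenbasis_def)
  have p: "ip p (e m) = (if a m = l then ip x (e m) else 0)" if "m \<in> {1..M}" for m
    unfolding p_def using orthonormal_sum[OF on _ that] by simp
  have E: "y \<in> ?E \<longleftrightarrow> (\<forall>m\<in>{1..M}. a m \<noteq> l \<longrightarrow> ip y (e m) = 0)" for y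
    using eigenspace_eigenbasis[OF eb sa, of y "of_real l"] by simp
  have pE: "p \<in> ?E" unfolding E using p by simp
  have orth: "ip (x - p) z = 0" if "z \<in> ?E" for z
    unfolding orthonormal_ip[OF on, of "x - p" z]
    using p that ip_eq_0_commute unfolding E by (intro sum.neutral) (auto simp: ip_diff_left)
  have "orth_proj ip ?E x = p"
    unfolding orth_proj_def
  proof (rule the_equality)
    fix y assume y: "y \<in> ?E \<and> (\<forall>z\<in>?E. ip (x - y) z = 0)"
    have "ip y (e m) = ip p (e m)" if m: "m \<in> {1..M}" for m
    proof (cases "a m = l")
      case True
      then have "e m \<in> ?E" unfolding E using on m by (auto simp: orthonormal_on_def)
      then have "ip (x - y) (e m) = 0" using y by blast
      then show ?thesis using p[OF m] True by (simp add: ip_diff_left)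
    next
      case False
      then show ?thesis using y p[OF m] m unfolding E by simp
    qed
    then show "y = p" by (rule orthonormal_eqI[OF on])
  qed (use pE orth in simp)
  moreover have "(hnorm ip p)\<^sup>2 = nsq p" by (simp add: hnorm_def)
  moreover have "nsq p = (\<Sum>m\<in>{1..M}. if a m = l then (norm (ip x (e m)))\<^sup>2 else 0)"
    unfolding orthonormal_nsq[OF on, of p] by (intro sum.cong) (simp_all add: p)
  ultimately show ?thesis by (simp only: sum.inter_filter finite_atLeastAtMost)
qed

section \<open>Interlacing under rank-one updates\<close>

lemma eigenbasis_quad_form:
  assumes eb: "eigenbasis scl ip M T e a" and sa: "self_adjoint scl ip T"
  shows "quad_form ip T x = (\<Sum>m\<in>{1..M}. a m * (norm (ip x (e m)))\<^sup>2)"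
proof (rule quad_form_eqI)
  have on: "orthonormal_on ip {1..M} e" using eb by (simp add: eigenbasis_def)
  have "ip (T x) x = (\<Sum>m\<in>{1..M}. of_real (a m) * (ip x (e m) * ip (e m) x))"
    by (subst orthonormal_ip[OF on, of "T x" x], intro sum.cong refl)
       (simp add: eigenbasis_coord[OF eb sa])
  then show "ip (T x) x = of_real (\<Sum>m\<in>{1..M}. a m * (norm (ip x (e m)))\<^sup>2)"
    by (simp only: ip_commute_mult of_real_sum of_real_mult)
qed

text \<open>
  This bound and the next one are the two halves of the Courant--Fischer principle: a vector without
  components along the smaller eigenvalues has a large Rayleigh quotient, and conversely.
\<close>

lemma eigenbasis_quad_form_ge:
  assumes eb: "eigenbasis scl ip M T e a" and sa: "self_adjoint scl ip T" and m: "m \<in> {1..M}"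
    and orth: "\<And>i. i \<in> {Suc m..M} \<Longrightarrow> ip x (e i) = 0"
  shows "a m * nsq x \<le> quad_form ip T x"
proof -
  have on: "orthonormal_on ip {1..M} e" and mono: "antimono_on {1..M} a"
    using eb by (simp_all add: eigenbasis_def)
  show ?thesis
    unfolding eigenbasis_quad_form[OF eb sa] orthonormal_nsq[OF on, of x] sum_distrib_left
  proof (rule sum_mono)
    fix i assume i: "i \<in> {1..M}"
    show "a m * (norm (ip x (e i)))\<^sup>2 \<le> a i * (norm (ip x (e i)))\<^sup>2"
      using monotone_onD[OF mono i m] orth[of i] i
      by (cases "i \<le> m") (auto intro!: mult_right_mono)
  qed
qed

lemma eigenbasis_quad_form_le:
  assumes eb: "eigenbasis scl ip M T e a" and sa: "self_adjoint scl ip T" and m: "m \<in> {1..M}"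
    and orth: "\<And>i. i \<in> {1..<m} \<Longrightarrow> ip x (e i) = 0"
  shows "quad_form ip T x \<le> a m * nsq x"
proof -
  have on: "orthonormal_on ip {1..M} e" and mono: "antimono_on {1..M} a"
    using eb by (simp_all add: eigenbasis_def)
  show ?thesis
    unfolding eigenbasis_quad_form[OF eb sa] orthonormal_nsq[OF on, of x] sum_distrib_left
  proof (rule sum_mono)
    fix i assume i: "i \<in> {1..M}"
    show "a i * (norm (ip x (e i)))\<^sup>2 \<le> a m * (norm (ip x (e i)))\<^sup>2"
      using monotone_onD[OF mono m i] orth[of i] i
      by (cases "m \<le> i") (auto intro!: mult_right_mono)
  qed
qed

lemma rank_one_quad_form:
  assumes "self_adjoint scl ip A" "\<And>x. B x = A x + scl (ip x f) f"
  shows "quad_form ip B x = quad_form ip A x + (norm (ip x f))\<^sup>2"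
  by (rule quad_form_eqI)
     (simp only: assms(2) ip_add_left ip_scale_left quad_form[OF assms(1)] ip_commute_mult of_real_add)

text \<open>
  The dimension count behind the Courant--Fischer comparison: the vectors to which \<open>x\<close> must be orthogonal
  number \<open>(m - 1) + (M - p) + card H < M\<close>.
\<close>

lemma exists_orthogonal_vector3:
  assumes "m \<le> p" "p \<le> M" "1 \<le> m" "finite H" "card H + M \<le> p + (M - m)"
  shows "\<exists>x. x \<noteq> 0 \<and> (\<forall>i\<in>{1..<m}. ip x (e i) = 0) \<and> (\<forall>i\<in>{Suc p..M}. ip x (u i) = 0) \<and> (\<forall>y\<in>H. ip x y = 0)"
proof -
  let ?G = "e ` {1..<m} \<union> u ` {Suc p..M} \<union> H"
  have "card ?G \<le> card (e ` {1..<m}) + card (u ` {Suc p..M}) + card H"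
    by (meson card_Un_le order.trans add_le_mono1)
  also have "\<dots> \<le> (m - 1) + (M - p) + card H"
    using card_image_le[of "{1..<m}" e] card_image_le[of "{Suc p..M}" u] by simp
  finally have "card ?G < M" using assms by linarith
  then obtain x where "x \<noteq> 0" "\<forall>y\<in>?G. ip x y = 0"
    using exists_orthogonal_vector[of ?G] assms(4) by auto
  then show ?thesis by blast
qed

text \<open>
  For \<open>a m \<le> g m\<close> use that \<open>B\<close> dominates \<open>A\<close>. For \<open>g (Suc m) \<le> a m\<close> restrict to vectors orthogonal to
  \<open>f\<close>, where both forms agree; this costs one dimension and therefore shifts the index by one.
\<close>

lemma rank_one_interlaces:
  assumes A: "eigenbasis scl ip M A e a" "self_adjoint scl ip A"
    and B: "eigenbasis scl ip M B u g" "self_adjoint scl ip B"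
    and upd: "\<And>x. B x = A x + scl (ip x f) f"
  shows "interlaces M a g"
  unfolding interlaces_def
proof (intro conjI ballI)
  fix m assume m: "m \<in> {1..M}"
  obtain x where x: "x \<noteq> 0" "\<And>i. i \<in> {1..<m} \<Longrightarrow> ip x (u i) = 0" "\<And>i. i \<in> {Suc m..M} \<Longrightarrow> ip x (e i) = 0"
    using exists_orthogonal_vector3[of m m "{}" u e] m by auto
  have "a m * nsq x \<le> quad_form ip A x" using eigenbasis_quad_form_ge[OF A m x(3)] .
  also have "\<dots> \<le> quad_form ip B x" using rank_one_quad_form[OF A(2) upd] by simp
  also have "\<dots> \<le> g m * nsq x" using eigenbasis_quad_form_le[OF B m x(2)] .
  finally show "a m \<le> g m" using nsq_pos[OF x(1)] by (simp only: mult_le_cancel_right_pos)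
next
  fix m assume m: "m \<in> {1..<M}"
  then have m': "m \<in> {1..M}" "Suc m \<in> {1..M}" by auto
  obtain x where x: "x \<noteq> 0" "\<And>i. i \<in> {1..<m} \<Longrightarrow> ip x (e i) = 0"
    "\<And>i. i \<in> {Suc (Suc m)..M} \<Longrightarrow> ip x (u i) = 0" "ip x f = 0"
    using exists_orthogonal_vector3[of m "Suc m" "{f}" e u] m by auto
  have "g (Suc m) * nsq x \<le> quad_form ip B x" using eigenbasis_quad_form_ge[OF B m'(2) x(3)] .
  also have "\<dots> = quad_form ip A x" using rank_one_quad_form[OF A(2) upd, of x] x(4) by simp
  also have "\<dots> \<le> a m * nsq x" using eigenbasis_quad_form_le[OF A m'(1) x(2)] .
  finally show "g (Suc m) \<le> a m" using nsq_pos[OF x(1)] by (simp only: mult_le_cancel_right_pos)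
qed

section \<open>Characteristic polynomials under rank-one updates\<close>

text \<open>
  It suffices that the multiplicity of every root \<open>c\<close> of \<open>p\<^sub>g\<close>, which is the dimension of the
  \<open>c\<close>-eigenspace of \<open>B\<close>, is at most its order as a root of the secular polynomial. The two eigenspaces
  at \<open>c\<close> contain the same vectors orthogonal to \<open>f\<close>, so their dimensions compare according to whether
  each of them is orthogonal to \<open>f\<close>.
\<close>

lemma rank_one_root_poly:
  assumes A: "eigenbasis scl ip M A e a" "self_adjoint scl ip A"
    and B: "eigenbasis scl ip M B u g" "self_adjoint scl ip B"
    and upd: "\<And>x. B x = A x + scl (ip x f) f"
  shows "root_poly {1..M} g = secular_poly M a (\<lambda>m. (norm (ip f (e m)))\<^sup>2)"
proof (rule root_poly_eq_secular_poly, rule root_poly_dvdI)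
  fix c
  let ?w = "\<lambda>m. (norm (ip f (e m)))\<^sup>2" and ?x = "[:- c, 1:] :: real poly"
  let ?EA = "eigenspace scl A (of_real c)" and ?EB = "eigenspace scl B (of_real c)"
  have on: "orthonormal_on ip {1..M} e" using A(1) by (simp add: eigenbasis_def)
  have cA: "root_count {1..M} a c = dim ?EA"
    by (rule root_count_is_spectrum[OF eigenbasis_is_spectrum[OF A]])
  have cB: "root_count {1..M} g c = dim ?EB"
    by (rule root_count_is_spectrum[OF eigenbasis_is_spectrum[OF B]])
  have EB: "x \<in> ?EB \<longleftrightarrow> scl (of_real c) x = A x + scl (ip x f) f" for x
    by (simp add: eigenspace_def upd)
  show "?x ^ root_count {1..M} g c dvd secular_poly M a ?w"
  \<comment> \<open>If some eigenvector x of B is not orthogonal to f, then the eigenvalue equation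
    \<open>(c - A) x = \<langle>x, f\<rangle> f\<close> shows that f is orthogonal to the eigenspace of A at c, and pairing its
    solution with f shows that the secular function vanishes at c.\<close>
  proof (cases "\<exists>x\<in>?EB. ip x f \<noteq> 0")
    case True
    then obtain x where x: "x \<in> ?EB" "ip x f \<noteq> 0" by blast
    have coord: "(of_real c - of_real (a m)) * ip x (e m) = ip x f * ip f (e m)" if "m \<in> {1..M}" for m
    proof -
      have "ip (scl (of_real c) x) (e m) = ip (A x + scl (ip x f) f) (e m)"
        using x(1) unfolding EB by simp
      then show ?thesis
        by (simp add: ip_scale_left ip_add_left eigenbasis_coord[OF A that] left_diff_distrib)
    qed
    have w0: "?w m = 0" if "m \<in> {1..M}" "a m = c" for m
      using coord[OF that(1)] that(2) x(2) by simp
    have "ip x f = (\<Sum>m\<in>{1..M}. ip x (e m) * ip (e m) f)" by (rule orthonormal_ip[OF on])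
    also have "\<dots> = (\<Sum>m\<in>{m\<in>{1..M}. a m \<noteq> c}. ip x (e m) * ip (e m) f)"
      using w0 ip_eq_0_commute by (intro sum.mono_neutral_right) auto
    also have "\<dots> = (\<Sum>m\<in>{m\<in>{1..M}. a m \<noteq> c}. ip x f * of_real (?w m / (c - a m)))"
    proof (rule sum.cong[OF refl])
      fix m assume m: "m \<in> {m\<in>{1..M}. a m \<noteq> c}"
      then have ne: "(of_real c - of_real (a m) :: 'k) \<noteq> 0" by auto
      then have "ip x (e m) = ip x f * ip f (e m) / (of_real c - of_real (a m))"
        using coord[of m] m by (simp add: field_simps)
      then show "ip x (e m) * ip (e m) f = ip x f * of_real (?w m / (c - a m))"
        by (simp only: of_real_divide of_real_diff ip_commute_mult[symmetric] times_divide_eq_left times_divide_eq_right mult.assoc)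
    qed
    also have "\<dots> = ip x f * of_real (\<Sum>m\<in>{m\<in>{1..M}. a m \<noteq> c}. ?w m / (c - a m))"
      by (simp only: sum_distrib_left of_real_sum)
    finally have "of_real (\<Sum>m\<in>{m\<in>{1..M}. a m \<noteq> c}. ?w m / (c - a m)) = (of_real 1 :: 'k)"
      using x(2) by (simp del: of_real_sum)
    then have one: "(\<Sum>m\<in>{m\<in>{1..M}. a m \<noteq> c}. ?w m / (c - a m)) = 1"
      unfolding of_real_eq_iff .
    obtain h where h: "secular_poly M a ?w = ?x ^ root_count {1..M} a c * h"
      and "poly h c = poly (root_poly {m\<in>{1..M}. a m \<noteq> c} a) c *
        (1 - (\<Sum>m\<in>{m\<in>{1..M}. a m \<noteq> c}. ?w m / (c - a m)))"
      by (rule secular_poly_factor[of M a c ?w]) (use w0 in auto)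
    then have "?x dvd h" unfolding one by (simp add: poly_eq_0_iff_dvd)
    then have dvd: "?x ^ Suc (root_count {1..M} a c) dvd secular_poly M a ?w"
      unfolding h power_Suc2 by (rule mult_dvd_mono[OF dvd_refl])
    have "root_count {1..M} g c \<le> Suc (root_count {1..M} a c)"
      using B(1) by (intro interlaces_root_count rank_one_interlaces[OF A B upd]) (simp add: eigenbasis_def)
    then show ?thesis by (rule dvd_trans[OF le_imp_power_dvd dvd])
  next
    case False
    \<comment> \<open>Otherwise B acts like A on its eigenspace at c.\<close>
    then have sub: "?EB \<subseteq> ?EA"
    proof (intro subsetI)
      fix x assume x: "x \<in> ?EB"
      then have "ip x f = 0" using False by blast
      then show "x \<in> ?EA" using x unfolding EB by (simp add: eigenspace_def)
    qed
    obtain Bs where fd: "finite_dimensional_vector_space scl Bs" by (rule independent_basis)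
    interpret fd: finite_dimensional_vector_space scl Bs by (rule fd)
    show ?thesis
    proof (cases "\<forall>m\<in>{1..M}. a m = c \<longrightarrow> ?w m = 0")
      case True
      then obtain h where h: "secular_poly M a ?w = ?x ^ root_count {1..M} a c * h"
        using secular_poly_factor[of M a c ?w] by metis
      have "root_count {1..M} g c \<le> root_count {1..M} a c"
        unfolding cA cB by (rule fd.dim_subset[OF sub])
      then show ?thesis unfolding h by (intro dvd_mult2 le_imp_power_dvd)
    next
      case nz: False
      then obtain m where m: "m \<in> {1..M}" "a m = c" "ip f (e m) \<noteq> 0" by auto
      \<comment> \<open>Now \<open>e m\<close> shows that the inclusion of eigenspaces is strict, which pays for the factor that the
        secular polynomial may lose.\<close>
      have "e m \<in> ?EA" using A(1) m by (simp add: eigenspace_def eigenbasis_def)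
      moreover have "e m \<notin> ?EB" using False m(3) ip_eq_0_commute by blast
      ultimately have "span ?EB \<subset> span ?EA"
        using sub eigenspace_subspace[OF A(2)] eigenspace_subspace[OF B(2)] by (simp only: span_eq_iff[THEN iffD2]) blast
      then have "dim ?EB < dim ?EA" by (rule fd.dim_psubset)
      then have "root_count {1..M} g c \<le> root_count {1..M} a c - 1"
        unfolding cA cB by linarith
      then show ?thesis by (rule dvd_trans[OF le_imp_power_dvd secular_poly_dvd_pred])
    qed
  qed
qed simp

lemma rank_one_residue:
  assumes A: "eigenbasis scl ip M A e a" "self_adjoint scl ip A"
    and B: "eigenbasis scl ip M B u g" "self_adjoint scl ip B"
    and upd: "\<And>x. B x = A x + scl (ip x f) f"
  shows "((\<lambda>x. (x - l) * (poly (root_poly {1..M} g) x / poly (root_poly {1..M} a) x)) \<longlongrightarrow>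
    - (hnorm ip (orth_proj ip (eigenspace scl A (of_real l)) f))\<^sup>2) (at l)"
  unfolding rank_one_root_poly[OF assms] hnorm_orth_proj_eigenspace[OF A]
  by (rule secular_poly_residue)

section \<open>Frame operators\<close>

lemma frame_operator_self_adjoint: "self_adjoint scl ip (frame_operator scl ip F n)"
  unfolding self_adjoint_def
proof (intro conjI allI)
  show "Vector_Spaces.linear scl scl (frame_operator scl ip F n)"
    unfolding linear_iff_scl frame_operator_def
    by (simp add: ip_add_left ip_scale_left scale_left_distrib sum.distrib scale_sum_right)
  show "ip (frame_operator scl ip F n x) y = ip x (frame_operator scl ip F n y)" for x y
    unfolding frame_operator_def ip_sum_left ip_sum_right ip_scale_left ip_scale_right
    by (intro sum.cong refl) (metis ip_commute mult.commute)
qed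

lemma frame_operator_Suc:
  "frame_operator scl ip F (Suc n) x = frame_operator scl ip F n x + scl (ip x (F (Suc n))) (F (Suc n))"
  by (simp add: frame_operator_def)

lemma frame_quad_form:
  "quad_form ip (frame_operator scl ip F n) x = (\<Sum>k\<in>{1..n}. (norm (ip x (F k)))\<^sup>2)"
  by (rule quad_form_eqI) (simp only: frame_operator_def ip_sum_left ip_scale_left ip_commute_mult of_real_sum)

text \<open>
  The form of the frame operator at \<open>x\<close> is the sum of the \<open>|\<langle>x, F k\<rangle>|\<^sup>2\<close>; evaluating it at a unit
  eigenvector gives the eigenvalue, and in particular its nonnegativity.
\<close>

lemma frame_eigenvalue:
  assumes "eigenbasis scl ip M (frame_operator scl ip F n) e a" "m \<in> {1..M}"
  shows "a m = (\<Sum>k\<in>{1..n}. (norm (ip (F k) (e m)))\<^sup>2)"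
proof -
  have "quad_form ip (frame_operator scl ip F n) (e m) = a m"
    using assms by (intro quad_form_eqI) (simp add: eigenbasis_def orthonormal_on_def ip_scale_left)
  then show ?thesis unfolding frame_quad_form norm_ip_commute[of "e m"] by simp
qed

text \<open>
  Summing the eigenvalues and exchanging the sums leaves Parseval's identity for each vector.
\<close>

lemma frame_trace:
  assumes "eigenbasis scl ip M (frame_operator scl ip F n) e a"
  shows "(\<Sum>m\<in>{1..M}. a m) = (\<Sum>k\<in>{1..n}. (hnorm ip (F k))\<^sup>2)"
proof -
  have on: "orthonormal_on ip {1..M} e" using assms by (simp add: eigenbasis_def)
  have "(\<Sum>m\<in>{1..M}. a m) = (\<Sum>m\<in>{1..M}. \<Sum>k\<in>{1..n}. (norm (ip (F k) (e m)))\<^sup>2)"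
    by (intro sum.cong refl frame_eigenvalue[OF assms])
  also have "\<dots> = (\<Sum>k\<in>{1..n}. nsq (F k))"
    unfolding orthonormal_nsq[OF on] by (rule sum.swap)
  finally show ?thesis by (simp add: hnorm_def)
qed

text \<open>
  The spectra of the partial frame operators are the eigensteps.
\<close>

lemma frame_eigensteps:
  assumes spec: "is_spectrum scl (frame_operator scl ip F N) M lam"
    and norms: "\<And>n. n \<in> {1..N} \<Longrightarrow> (hnorm ip (F n))\<^sup>2 = mu n"
  shows "\<exists>E. eigensteps M N lam mu E \<and> step_B scl ip M N mu E F"
proof -
  let ?T = "frame_operator scl ip F"
  have "\<forall>n. \<exists>e a. eigenbasis scl ip M (?T n) e a"
    using eigenbasis_exists frame_operator_self_adjoint by blast
  then obtain e E where eb: "\<And>n. eigenbasis scl ip M (?T n) (e n) (E n)" by metis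
  note sa = frame_operator_self_adjoint[of F]
  have "eigensteps M N lam mu E"
    unfolding eigensteps_def
  proof (intro conjI ballI)
    show "antimono_on {1..M} (E n)" for n using eb[of n] by (simp add: eigenbasis_def)
    show "0 \<le> E n m" if "m \<in> {1..M}" for n m
      unfolding frame_eigenvalue[OF eb that] by (intro sum_nonneg) simp
    show "E 0 m = 0" if "m \<in> {1..M}" for m
      unfolding frame_eigenvalue[OF eb that] by simp
    show "E N m = lam m" if "m \<in> {1..M}" for m
      by (rule is_spectrum_unique[OF eigenbasis_is_spectrum[OF eb sa] spec that])
    show "interlaces M (E (n - 1)) (E n)" if "n \<in> {1..N}" for n
    proof -
      have "?T n x = ?T (n - 1) x + scl (ip x (F n)) (F n)" for x
        using frame_operator_Suc[of F "n - 1" x] that by simp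
      then show ?thesis by (rule rank_one_interlaces[OF eb sa eb sa])
    qed
    show "(\<Sum>m\<in>{1..M}. E n m) = (\<Sum>k\<in>{1..n}. mu k)" if "n \<in> {1..N}" for n
      unfolding frame_trace[OF eb] using norms that by (intro sum.cong) auto
  qed
  moreover have "step_B scl ip M N mu E F"
    unfolding step_B_def
  proof (intro conjI impI ballI)
    show "(hnorm ip (F 1))\<^sup>2 = mu 1" if "1 \<le> N" using norms[of 1] that by simp
    fix n l
    have "(step_quotient M E n l \<longlongrightarrow>
        - (hnorm ip (orth_proj ip (eigenspace scl (?T n) (of_real l)) (F (Suc n))))\<^sup>2) (at l)"
      unfolding step_quotient_root_poly
      by (rule rank_one_residue[OF eb sa eb sa frame_operator_Suc])
    then show "(hnorm ip (orth_proj ip (eigenspace scl (?T n) (of_real l)) (F (n + 1))))\<^sup>2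
        = - Lim (at l) (step_quotient M E n l)"
      by (simp add: tendsto_Lim)
  qed
  ultimately show ?thesis by blast
qed

text \<open>
  The induction starts at \<open>n = 0\<close>, where the frame operator is zero. In the step, the true spectrum \<open>g\<close> of
  the next frame operator and the prescribed list \<open>E (Suc n)\<close> both interlace on \<open>E n\<close> and have the same
  residues, so the polynomials with these roots agree.
\<close>

lemma step_B_is_spectrum:
  assumes es: "eigensteps M N lam mu E" and sB: "step_B scl ip M N mu E F"
  shows "n \<le> N \<Longrightarrow> is_spectrum scl (frame_operator scl ip F n) M (E n)"
proof (induction n)
  let ?T = "frame_operator scl ip F"
  note sa = frame_operator_self_adjoint[of F]
  {
    case 0
    obtain e a where eb: "eigenbasis scl ip M (?T 0) e a" using eigenbasis_exists[OF sa] by blast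
    have "a m = E 0 m" if "m \<in> {1..M}" for m
      using frame_eigenvalue[OF eb that] es that by (simp add: eigensteps_def)
    then show ?case by (rule is_spectrum_cong[OF eigenbasis_is_spectrum[OF eb sa]])
  next
    case (Suc n)
    then have n: "n < N" and IH: "is_spectrum scl (?T n) M (E n)" by auto
    have mono: "antimono_on {1..M} (E n)" "antimono_on {1..M} (E (Suc n))"
      and int: "interlaces M (E n) (E (Suc n))"
      and sum: "(\<Sum>m\<in>{1..M}. E (Suc n) m) = (\<Sum>k\<in>{1..Suc n}. mu k)"
      using es n unfolding eigensteps_def by (auto dest: bspec[where x = "Suc n"])
    obtain e a where ebn: "eigenbasis scl ip M (?T n) e a" using eigenbasis_exists[OF sa] by blast
    have aE: "a m = E n m" if "m \<in> {1..M}" for m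
      by (rule is_spectrum_unique[OF eigenbasis_is_spectrum[OF ebn sa] IH that])
    have eb: "eigenbasis scl ip M (?T n) e (E n)"
      using ebn aE mono(1) by (simp add: eigenbasis_def)
    obtain u g where eb': "eigenbasis scl ip M (?T (Suc n)) u g" using eigenbasis_exists[OF sa] by blast
    have g_mono: "antimono_on {1..M} g" using eb' by (simp add: eigenbasis_def)
    have g_int: "interlaces M (E n) g"
      by (rule rank_one_interlaces[OF eb sa eb' sa frame_operator_Suc])
    have "g m = E (Suc n) m" if m: "m \<in> {1..M}" for m
    \<comment> \<open>For the first vector only the norm is prescribed. A list that interlaces on the zero list is
      determined by its sum.\<close>
    proof (cases "n = 0")
      case True
      have tail: "h m = (if m = 1 then (\<Sum>m\<in>{1..M}. h m) else 0)"
        if h: "interlaces M (E n) h" and m: "m \<in> {1..M}" for h m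
      proof -
        have E0: "E n m = 0" if "m \<in> {1..M}" for m
          using es True that by (simp add: eigensteps_def)
        have z: "h j = 0" if "j \<in> {2..M}" for j
        proof -
          have j: "j - 1 \<in> {1..<M}" "Suc (j - 1) = j" "j \<in> {1..M}" using that by auto
          then have "h (Suc (j - 1)) \<le> E n (j - 1)" "E n j \<le> h j"
            using h unfolding interlaces_def by blast+
          then show ?thesis using E0[of j] E0[of "j - 1"] j by simp
        qed
        have "(\<Sum>j\<in>{1..M}. h j) = h 1 + (\<Sum>j\<in>{2..M}. h j)"
          using m sum.atLeast_Suc_atMost[of 1 M h] by (simp add: numeral_2_eq_2)
        then show ?thesis using z m by auto
      qed
      have "(\<Sum>m\<in>{1..M}. g m) = (\<Sum>m\<in>{1..M}. E (Suc n) m)"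
        using frame_trace[OF eb'] sB n True sum by (simp add: step_B_def)
      then show ?thesis using tail[OF g_int m] tail[OF int m] by simp
    next
      case False
      have "root_poly {1..M} g = root_poly {1..M} (E (Suc n))"
      proof (rule root_poly_eq_of_residues[OF mono(1) g_int int])
        fix l assume l: "l \<in> E n ` {1..M}"
        let ?p = "(hnorm ip (orth_proj ip (eigenspace scl (?T n) (of_real l)) (F (Suc n))))\<^sup>2"
        obtain L where L: "(step_quotient M E n l \<longlongrightarrow> L) (at l)"
          using eigensteps_residue_nonpos[OF es _ l] n by auto
        moreover have "?p = - Lim (at l) (step_quotient M E n l)"
        proof -
          have "n \<in> {1..<N}" using False n by simp
          with sB l have "(hnorm ip (orth_proj ip (eigenspace scl (?T n) (of_real l)) (F (n + 1))))\<^sup>2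
              = - Lim (at l) (step_quotient M E n l)"
            unfolding step_B_def by blast
          then show ?thesis by simp
        qed
        ultimately have "L = - ?p" by (simp add: tendsto_Lim)
        then show "\<exists>L.
          ((\<lambda>x. (x - l) * (poly (root_poly {1..M} g) x / poly (root_poly {1..M} (E n)) x)) \<longlongrightarrow> L) (at l) \<and>
          ((\<lambda>x. (x - l) * (poly (root_poly {1..M} (E (Suc n))) x / poly (root_poly {1..M} (E n)) x)) \<longlongrightarrow> L) (at l)"
          using rank_one_residue[OF eb sa eb' sa frame_operator_Suc] L
          unfolding step_quotient_root_poly by blast
      qed
      then have "root_count {1..M} g = root_count {1..M} (E (Suc n))"
        by (intro ext) (metis order_root_poly finite_atLeastAtMost)
      then show ?thesis by (rule antimono_root_count_unique[OF g_mono mono(2) _ m])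
    qed
    then show ?case by (rule is_spectrum_cong[OF eigenbasis_is_spectrum[OF eb' sa]])
  }
qed

text \<open>
  The sums of the squared norms and of the numbers \<open>mu\<close> agree up to each index, as both are the sum of
  the corresponding eigenstep.
\<close>

lemma step_B_norms:
  assumes es: "eigensteps M N lam mu E" and sB: "step_B scl ip M N mu E F" and n: "n \<in> {1..N}"
  shows "(hnorm ip (F n))\<^sup>2 = mu n"
proof -
  let ?T = "frame_operator scl ip F"
  note sa = frame_operator_self_adjoint[of F]
  have total: "(\<Sum>k\<in>{1..i}. (hnorm ip (F k))\<^sup>2) = (\<Sum>k\<in>{1..i}. mu k)" if i: "i \<le> N" for i
  proof (cases "i = 0")
    case False
    obtain e a where eb: "eigenbasis scl ip M (?T i) e a" using eigenbasis_exists[OF sa] by blast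
    have "(\<Sum>m\<in>{1..M}. a m) = (\<Sum>m\<in>{1..M}. E i m)"
      by (intro sum.cong refl is_spectrum_unique[OF eigenbasis_is_spectrum[OF eb sa] step_B_is_spectrum[OF es sB i]])
    then show ?thesis
      using frame_trace[OF eb] es False i by (simp add: eigensteps_def)
  qed simp
  obtain i where i: "n = Suc i" using n by (cases n) auto
  show ?thesis using total[of "Suc i"] total[of i] n unfolding i by simp
qed

end

section \<open>Construction of all frames with given spectrum and norms\<close>

theorem theorem2:
  fixes scl :: "'k::real_or_complex \<Rightarrow> 'v::ab_group_add \<Rightarrow> 'v"
    and ip :: "'v \<Rightarrow> 'v \<Rightarrow> 'k"
    and M N :: nat
    and lam mu :: "nat \<Rightarrow> real"
  assumes "hilbert_space_dim scl ip M"
    and "\<forall>m\<in>{1..M}. 0 \<le> lam m" and "antimono_on {1..M} lam"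
    and "\<forall>n\<in>{1..N}. 0 \<le> mu n" and "antimono_on {1..N} mu"
  shows
    "(\<forall>F. is_spectrum scl (frame_operator scl ip F N) M lam \<and>
          (\<forall>n\<in>{1..N}. (hnorm ip (F n))\<^sup>2 = mu n) \<longrightarrow>
          (\<exists>E. eigensteps M N lam mu E \<and> step_B scl ip M N mu E F)) \<and>
     (\<forall>E. eigensteps M N lam mu E \<longrightarrow>
          (\<forall>n\<in>{1..<N}. \<forall>l\<in>E n ` {1..M}.
             \<exists>L\<le>0. (step_quotient M E n l \<longlongrightarrow> L) (at l))) \<and>
     (\<forall>E F. eigensteps M N lam mu E \<and> step_B scl ip M N mu E F \<longrightarrow>
          is_spectrum scl (frame_operator scl ip F N) M lam \<and>
          (\<forall>n\<in>{1..N}. (hnorm ip (F n))\<^sup>2 = mu n) \<and>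
          (\<forall>n\<in>{1..N}. is_spectrum scl (frame_operator scl ip F n) M (E n)))"
proof -
  interpret hilbert_space_dim scl ip M by (rule assms(1))
  show ?thesis
  proof (intro conjI allI impI ballI; (elim conjE)?)
    fix F assume "is_spectrum scl (frame_operator scl ip F N) M lam"
      and "\<forall>n\<in>{1..N}. (hnorm ip (F n))\<^sup>2 = mu n"
    then show "\<exists>E. eigensteps M N lam mu E \<and> step_B scl ip M N mu E F"
      by (intro frame_eigensteps) auto
  next
    fix E n l assume "eigensteps M N lam mu E" "n \<in> {1..<N}" "l \<in> E n ` {1..M}"
    then show "\<exists>L\<le>0. (step_quotient M E n l \<longlongrightarrow> L) (at l)"
      by (intro eigensteps_residue_nonpos) auto
  next
    fix E F assume es: "eigensteps M N lam mu E" and sB: "step_B scl ip M N mu E F"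
    show "is_spectrum scl (frame_operator scl ip F N) M lam"
      using es by (intro is_spectrum_cong[OF step_B_is_spectrum[OF es sB order_refl]]) (simp add: eigensteps_def)
    show "(hnorm ip (F n))\<^sup>2 = mu n" if "n \<in> {1..N}" for n
      by (rule step_B_norms[OF es sB that])
    show "is_spectrum scl (frame_operator scl ip F n) M (E n)" if "n \<in> {1..N}" for n
      using that by (intro step_B_is_spectrum[OF es sB]) simp
  qed
qed

end
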